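(* Let $X$ be a compact metric space and let $f:X\to\mathbb{R}$ be piecewise monotone with monotone-light factorization $\mu M\lambda$, $f$ nonconstant on each connected component of $X$. Let $\mathcal{C}=\{C_i \mid i\in\mathcal{I}\}$ be a varilet lens for $f$, and let $\{g_i:X\to\mathbb{R}\mid i\in\mathcal{I}\}$ and $\{\alpha_i\mid i\in\mathcal{I}\}$ be the functions and amplitudes produced from $f$ and $\mathcal{C}$ by the Varilet Transform Algorithm. Then $\{g_i\mid i\in\mathcal{I}\}$ is a varilet basis, and $f=\sum_{i\in\mathcal{I}}\alpha_i g_i$.
   Context: All functions are continuous. For a subset $S$ of a space, $\partial S$ is its topological boundary and $\overline{S}$ its closure. Monotone-light factorization. A continuous map $h:X\to Y$ of compact metric spaces is monotone if $h^{-1}(y)$ is connected for every $y$ (the empty set counts as connected), and light if $h^{-1}(y)$ is totally disconnected for every $y$. Let $f:X\to\mathbb{R}$ be continuous, $X$ compact metric. Its middle space $M$ is the quotient of $X$ identifying two points when they lie in the same connected component of some $f^{-1}(y)$; $\mu:X\to M$ is the quotient map (monotone), and $\lambda:M\to\mathbb{R}$ is the induced map (light), so $f=\lambda\circ\mu$. The space $M$ is compact metric, and the factorization $f=\lambda\circ\mu$ into a monotone surjection followed by a light map is unique up to homeomorphism of $M$. One writes that $f$ has monotone-light factorization $\mu M\lambda$. Piecewise monotone. $\lambda$ is locally monotone at $p\in M$ if $p$ has a neighbourhood on which (the restriction of) $\lambda$ is monotone. Let $M^{\mathrm{loc}}$ be the set of such points. $f$ is piecewise monotone when (1) $M^{\mathrm{loc}}$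 is dense in $M$, (2) $M^{\mathrm{loc}}$ has finitely many components, (3) $\lambda$ is monotone on the closure of each component of $M^{\mathrm{loc}}$. The closures of the components of $M^{\mathrm{loc}}$ are the monotone pieces, or edges, of $M$; $\lambda$ maps each edge homeomorphically onto a compact real interval, so $M$ is a finite graph (possibly disconnected). The length of an edge is the length of its image interval under $\lambda$ (a one-point piece has length $0$). Topological total variation. For piecewise monotone $f$, $\mathit{TTV}(f)$ is the sum of the lengths of all edges of $M$. (The notions apply also to real-valued functions on $M$ or on closed subsets of $M$, which are compact metric spaces.) Varilet basis. A finite collection $\{g_i:X\to\mathbb{R}\}$ of piecewise monotone functions is a varilet basis when, for all choices of $a_i\in\mathbb{R}$, $\sum a_ig_i$ is piecewise monotone and $\mathit{TTV}(\sum a_ig_i)=\sum|a_i|$. Varilet lens. $C\subset M$ is a constant-boundary region if $C$ is closed, connected, has nonempty interior, and $\lambda$ is constant on $\partial C$ (boundary in $M$; possibly empty). Let $\mathcal{I}$ be a finite set of real numbers. A collection $\mathcal{C}=\{C_i\mid i\in\mathcal{I}\}$ of constant-boundary regions is nested when $i<j$ implies $C_i\supsetneq C_j$ or $C_i\cap C_j=\emptyset$. A varilet lens for $f$ is a nonempty nested collection $\mathcal{C}$ of constant-boundary regions with $\bigcup_{i\in\mathcal{I}}C_i=M$. Every connected component of $M$ is then a member of $\mathcal{C}$; these members are the root regions and their indices the root indices. When $i$ is not a root index, $\partial C_i\neq\emptyset$ and $\lambda(\partial C_i)$ denotes the constant value of $\lambda$ there. Varilet supports. $D_i=\overline{C_i\smallsetminus\bigcup_{j>i}C_j}$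 for $i\in\mathcal{I}$. Varilet Transform Algorithm. For each $i\in\mathcal{I}$: (1) $\alpha_i=\mathit{TTV}(\lambda|D_i)$. (2) Let $M^*$ be the connected component of $M$ containing $D_i$; define $\lambda_i:M\to\mathbb{R}$ on $M^*$ as the unique continuous extension of $\lambda|D_i$ that is constant on each component of $M^*\smallsetminus D_i$, and $\lambda_i\equiv0$ on all other components of $M$. (3) Define $\gamma_i:M\to\mathbb{R}$ on $M^*$ by $\gamma_i(p)=\alpha_i^{-1}\lambda_i(p)$ if $i$ is a root index and $\gamma_i(p)=\alpha_i^{-1}(\lambda_i(p)-\lambda(\partial C_i))$ otherwise, and $\gamma_i\equiv0$ on all other components of $M$. (4) $g_i=\gamma_i\circ\mu$. *)

theory Defs
  imports "HOL-Analysis.Analysis"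
begin

text \<open>
  All notions below are purely topological. A compact metric space is rendered as an abstract
  topology \<^term>\<open>X\<close> with \<^term>\<open>compact_space X\<close> and \<^term>\<open>metrizable_space X\<close>; a restriction
  of a function to a subset is the same function on a \<^const>\<open>subtopology\<close>. Only the values of a
  function on the \<^const>\<open>topspace\<close> matter.
\<close>

section \<open>The monotone-light factorization\<close>

text \<open>The points of the middle space are the connected components of the fibres, and
  \<open>monotone_part X f\<close> is the quotient map \<open>\<mu>\<close>.\<close>

definition monotone_part :: "'a topology \<Rightarrow> ('a \<Rightarrow> real) \<Rightarrow> 'a \<Rightarrow> 'a set" where
  "monotone_part X f x =
     connected_component_of_set (subtopology X {y \<in> topspace X. f y = f x}) x"

definition middle_space :: "'a topology \<Rightarrow> ('a \<Rightarrow> real) \<Rightarrow> 'a set topology" where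
  "middle_space X f =
     topology (\<lambda>U. U \<subseteq> monotone_part X f ` topspace X \<and>
                   openin X {x \<in> topspace X. monotone_part X f x \<in> U})"

text \<open>The induced map \<open>\<lambda>\<close>: \<^term>\<open>f\<close> has exactly one value on a component of a fibre.\<close>

definition light_part :: "('a \<Rightarrow> real) \<Rightarrow> 'a set \<Rightarrow> real" where
  "light_part f p = the_elem (f ` p)"

lemma openin_middle_space:
  "openin (middle_space X f) U \<longleftrightarrow>
     U \<subseteq> monotone_part X f ` topspace X \<and> openin X {x \<in> topspace X. monotone_part X f x \<in> U}"
proof -
  let ?m = "monotone_part X f"
  have "istopology (\<lambda>U. U \<subseteq> ?m ` topspace X \<and> openin X {x \<in> topspace X. ?m x \<in> U})"
    unfolding istopology_def
  proof (intro conjI allI impI)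
    fix S T
    assume S: "S \<subseteq> ?m ` topspace X \<and> openin X {x \<in> topspace X. ?m x \<in> S}"
      and T: "T \<subseteq> ?m ` topspace X \<and> openin X {x \<in> topspace X. ?m x \<in> T}"
    show "S \<inter> T \<subseteq> ?m ` topspace X" using S by blast
    have "{x \<in> topspace X. ?m x \<in> S \<inter> T} =
          {x \<in> topspace X. ?m x \<in> S} \<inter> {x \<in> topspace X. ?m x \<in> T}" by blast
    then show "openin X {x \<in> topspace X. ?m x \<in> S \<inter> T}" using S T by (simp add: openin_Int)
  next
    fix K
    assume K: "\<forall>S\<in>K. S \<subseteq> ?m ` topspace X \<and> openin X {x \<in> topspace X. ?m x \<in> S}"
    then show "\<Union> K \<subseteq> ?m ` topspace X" by blast
    have "{x \<in> topspace X. ?m x \<in> \<Union> K} = \<Union> ((\<lambda>S. {x \<in> topspace X. ?m x \<in> S}) ` K)" by blast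
    moreover have "openin X (\<Union> ((\<lambda>S. {x \<in> topspace X. ?m x \<in> S}) ` K))"
      using K by (intro openin_Union) blast
    ultimately show "openin X {x \<in> topspace X. ?m x \<in> \<Union> K}" by (simp only:)
  qed
  then show ?thesis by (simp add: middle_space_def)
qed

lemma topspace_middle_space: "topspace (middle_space X f) = monotone_part X f ` topspace X"
proof
  show "topspace (middle_space X f) \<subseteq> monotone_part X f ` topspace X"
    using openin_middle_space openin_topspace by blast
  have "{x \<in> topspace X. monotone_part X f x \<in> monotone_part X f ` topspace X} = topspace X"
    by blast
  then have "openin (middle_space X f) (monotone_part X f ` topspace X)"
    unfolding openin_middle_space by simp
  then show "monotone_part X f ` topspace X \<subseteq> topspace (middle_space X f)"
    by (rule openin_subset)
qed

lemma quotient_map_monotone_part: "quotient_map X (middle_space X f) (monotone_part X f)"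
  unfolding quotient_map_def by (auto simp: topspace_middle_space openin_middle_space)

lemma light_part_monotone_part:
  assumes "x \<in> topspace X"
  shows "light_part f (monotone_part X f x) = f x"
proof -
  let ?Y = "subtopology X {y \<in> topspace X. f y = f x}"
  have "x \<in> monotone_part X f x"
    using assms by (simp add: monotone_part_def connected_component_of_refl)
  moreover have "monotone_part X f x \<subseteq> {y \<in> topspace X. f y = f x}"
    unfolding monotone_part_def
    using connected_component_of_subset_topspace[of ?Y x] by auto
  ultimately have "f ` monotone_part X f x = {f x}" by blast
  then show ?thesis by (simp add: light_part_def)
qed

lemma continuous_map_light_part:
  assumes "continuous_map X euclideanreal f"
  shows "continuous_map (middle_space X f) euclideanreal (light_part f)"
proof -
  have "continuous_map X euclideanreal (light_part f \<circ> monotone_part X f)"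
    using assms by (rule continuous_map_eq) (simp add: light_part_monotone_part)
  then show ?thesis
    using continuous_compose_quotient_map[OF quotient_map_monotone_part] by blast
qed

section \<open>Piecewise monotone functions and topological total variation\<close>

definition locally_monotone_at :: "'a topology \<Rightarrow> ('a \<Rightarrow> real) \<Rightarrow> 'a \<Rightarrow> bool" where
  "locally_monotone_at M l p \<longleftrightarrow>
     (\<exists>N U. openin M U \<and> p \<in> U \<and> U \<subseteq> N \<and> N \<subseteq> topspace M \<and>
            monotone_map (subtopology M N) euclideanreal l)"

definition locally_monotone_points :: "'a topology \<Rightarrow> ('a \<Rightarrow> real) \<Rightarrow> 'a set" where
  "locally_monotone_points M l = {p \<in> topspace M. locally_monotone_at M l p}"

definition edges :: "'a topology \<Rightarrow> ('a \<Rightarrow> real) \<Rightarrow> 'a set set" where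
  "edges M l =
     (\<lambda>K. M closure_of K) `
       connected_components_of (subtopology M (locally_monotone_points M l))"

definition piecewise_monotone :: "'a topology \<Rightarrow> ('a \<Rightarrow> real) \<Rightarrow> bool" where
  "piecewise_monotone X f \<longleftrightarrow>
     continuous_map X euclideanreal f \<and>
     (let M = middle_space X f; l = light_part f; L = locally_monotone_points M l in
        M closure_of L = topspace M \<and>
        finite (connected_components_of (subtopology M L)) \<and>
        (\<forall>K \<in> connected_components_of (subtopology M L).
           monotone_map (subtopology M (M closure_of K)) euclideanreal l))"

text \<open>\<^term>\<open>Sup (l ` E) - Inf (l ` E)\<close> is the length of the compact interval \<^term>\<open>l ` E\<close>.\<close>

definition TTV :: "'a topology \<Rightarrow> ('a \<Rightarrow> real) \<Rightarrow> real" where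
  "TTV X f =
     (\<Sum>E \<in> edges (middle_space X f) (light_part f).
        Sup (light_part f ` E) - Inf (light_part f ` E))"

definition varilet_basis :: "'a topology \<Rightarrow> 'i set \<Rightarrow> ('i \<Rightarrow> 'a \<Rightarrow> real) \<Rightarrow> bool" where
  "varilet_basis X I g \<longleftrightarrow>
     finite I \<and> (\<forall>i\<in>I. piecewise_monotone X (g i)) \<and>
     (\<forall>a :: 'i \<Rightarrow> real.
        piecewise_monotone X (\<lambda>x. \<Sum>i\<in>I. a i * g i x) \<and>
        TTV X (\<lambda>x. \<Sum>i\<in>I. a i * g i x) = (\<Sum>i\<in>I. \<bar>a i\<bar>))"

section \<open>Varilet lenses\<close>

definition constant_boundary_region :: "'a topology \<Rightarrow> ('a \<Rightarrow> real) \<Rightarrow> 'a set \<Rightarrow> bool" where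
  "constant_boundary_region M l C \<longleftrightarrow>
     closedin M C \<and> connectedin M C \<and> M interior_of C \<noteq> {} \<and> l constant_on (M frontier_of C)"

definition nested :: "real set \<Rightarrow> (real \<Rightarrow> 'a set) \<Rightarrow> bool" where
  "nested I C \<longleftrightarrow> (\<forall>i\<in>I. \<forall>j\<in>I. i < j \<longrightarrow> C j \<subset> C i \<or> C i \<inter> C j = {})"

definition varilet_lens ::
  "'a topology \<Rightarrow> ('a \<Rightarrow> real) \<Rightarrow> real set \<Rightarrow> (real \<Rightarrow> 'a set) \<Rightarrow> bool" where
  "varilet_lens M l I C \<longleftrightarrow>
     finite I \<and> I \<noteq> {} \<and> (\<forall>i\<in>I. constant_boundary_region M l (C i)) \<and>
     nested I C \<and> (\<Union>i\<in>I. C i) = topspace M"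

definition is_root :: "'a topology \<Rightarrow> (real \<Rightarrow> 'a set) \<Rightarrow> real \<Rightarrow> bool" where
  "is_root M C i \<longleftrightarrow> C i \<in> connected_components_of M"

definition boundary_value :: "'a topology \<Rightarrow> ('a \<Rightarrow> real) \<Rightarrow> 'a set \<Rightarrow> real" where
  "boundary_value M l C = the_elem (l ` (M frontier_of C))"

section \<open>The Varilet Transform Algorithm\<close>

definition varilet_support ::
  "'a topology \<Rightarrow> real set \<Rightarrow> (real \<Rightarrow> 'a set) \<Rightarrow> real \<Rightarrow> 'a set" where
  "varilet_support M I C i = M closure_of (C i - (\<Union>j\<in>{j\<in>I. i < j}. C j))"

definition component_containing :: "'a topology \<Rightarrow> 'a set \<Rightarrow> 'a set" where
  "component_containing M D = (THE K. K \<in> connected_components_of M \<and> D \<subseteq> K)"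

text \<open>The value \<open>0\<close> is prescribed everywhere outside \<open>M\<^sup>*\<close>, also outside the space, so that the
  total function \<open>\<lambda>\<^sub>i\<close> is determined uniquely.\<close>

definition component_extension ::
  "'a topology \<Rightarrow> ('a \<Rightarrow> real) \<Rightarrow> 'a set \<Rightarrow> 'a \<Rightarrow> real" where
  "component_extension M l D =
     (let Ms = component_containing M D in
      THE h. continuous_map (subtopology M Ms) euclideanreal h \<and>
             (\<forall>p\<in>D. h p = l p) \<and>
             (\<forall>K \<in> connected_components_of (subtopology M (Ms - D)). h constant_on K) \<and>
             (\<forall>p. p \<notin> Ms \<longrightarrow> h p = 0))"

definition amplitude ::
  "'a topology \<Rightarrow> ('a \<Rightarrow> real) \<Rightarrow> real set \<Rightarrow> (real \<Rightarrow> 'a set) \<Rightarrow> real \<Rightarrow> real" where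
  "amplitude M l I C i = TTV (subtopology M (varilet_support M I C i)) l"

definition middle_varilet ::
  "'a topology \<Rightarrow> ('a \<Rightarrow> real) \<Rightarrow> real set \<Rightarrow> (real \<Rightarrow> 'a set) \<Rightarrow> real \<Rightarrow> 'a \<Rightarrow> real" where
  "middle_varilet M l I C i p =
     (let D = varilet_support M I C i;
          li = component_extension M l D;
          al = amplitude M l I C i
      in if p \<notin> component_containing M D then 0
         else if is_root M C i then inverse al * li p
         else inverse al * (li p - boundary_value M l (C i)))"

definition varilet ::
  "'a topology \<Rightarrow> ('a \<Rightarrow> real) \<Rightarrow> real set \<Rightarrow> (real \<Rightarrow> 'a set set) \<Rightarrow> real \<Rightarrow> 'a \<Rightarrow> real" where
  "varilet X f I C i =
     middle_varilet (middle_space X f) (light_part f) I C i \<circ> monotone_part X f"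

definition varilet_amplitude ::
  "'a topology \<Rightarrow> ('a \<Rightarrow> real) \<Rightarrow> real set \<Rightarrow> (real \<Rightarrow> 'a set set) \<Rightarrow> real \<Rightarrow> real" where
  "varilet_amplitude X f I C i = amplitude (middle_space X f) (light_part f) I C i"

end

theory Submission
  imports Defs
begin

text \<open>
  The middle space is covered by finitely many arcs on which \<open>\<lambda>\<close> is injective and which meet only at
  points extremal for \<open>\<lambda>\<close> on each of them. Conversely, a finite cover of a space by closed connected
  sets that meet only in extremal points, and on each of which a function is monotone, forces that
  function to be piecewise monotone with total variation the sum of the lengths of the images: pass
  to the middle space, where the sets become arcs, and merge arcs until they are the edges.

  Subdivide the edges at the boundary values of the lens into cells. Every cell lies in
  \<open>C\<^sub>i - \<Union>\<^sub>j\<^sub>>\<^sub>i C\<^sub>j\<close> for exactly one \<open>i\<close>; on its closure \<open>\<gamma>\<^sub>i\<close> is \<open>\<lambda>/\<alpha>\<^sub>i\<close> up to a constant and every other \<open>\<gamma>\<^sub>j\<close>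
  is constant. So a combination with coefficients \<open>a\<^sub>i\<close> is monotone on each closed cell and stretches it
  by \<open>\<bar>a\<^sub>i\<bar>/\<alpha>\<^sub>i\<close>, and summing over the cells belonging to \<open>i\<close>, whose total length is \<open>\<alpha>\<^sub>i\<close>, gives the
  total variation \<open>\<Sum>\<bar>a\<^sub>i\<bar>\<close>. Likewise \<open>\<lambda> - \<Sum>\<alpha>\<^sub>i\<gamma>\<^sub>i\<close> is constant on every cell, hence on every
  component, and it vanishes at a point of the root region there that lies in no other region.
\<close>

section \<open>The middle space of a compact Hausdorff space\<close>

text \<open>Changing the coefficients changes the edges: where \<lambda> passes monotonically
  through a vertex, a combination may turn back, and a zero coefficient collapses whole cells, so
  each combination has a middle space of its own. What survives is the condition that pieces meet
  only in extremal points, since rescaling each closed cell by its own affine map preserves it. This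
  is why covers, rather than edges, carry the proof. Extremality is also what lets lengths be added:
  a fibre component running from one piece into another must pass through a shared point, hence
  through an extremal level. As there are finitely many cells, a continuous function that is
  constant on each cell takes finitely many values on a connected component and is therefore
  constant there. Uniqueness of the extensions and the reconstruction of \<lambda> both rest on
  this. Nonconstancy of \<open>f\<close> on components enters as the absence of isolated points in
  the middle space; it makes every amplitude positive.\<close>

lemma monotone_part_self: "x \<in> topspace X \<Longrightarrow> x \<in> monotone_part X f x"
  by (simp add: monotone_part_def connected_component_of_refl)

lemma monotone_part_subset: "monotone_part X f x \<subseteq> {y \<in> topspace X. f y = f x}"
  unfolding monotone_part_def
  using connected_component_of_subset_topspace[of "subtopology X {y \<in> topspace X. f y = f x}" x]
  by auto

lemma connectedin_monotone_part: "connectedin X (monotone_part X f x)"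
  using connectedin_connected_component_of[of "subtopology X {y \<in> topspace X. f y = f x}" x]
  by (simp add: monotone_part_def connectedin_subtopology)

lemma monotone_part_maximal:
  assumes "connectedin X S" "x \<in> S" "y \<in> S" "f constant_on S"
  shows "monotone_part X f x = monotone_part X f y"
proof -
  let ?Y = "subtopology X {z \<in> topspace X. f z = f x}"
  have S: "S \<subseteq> {z \<in> topspace X. f z = f x}"
    using assms connectedin_subset_topspace[OF assms(1)] by (auto simp: constant_on_def)
  then have "connectedin ?Y S"
    using assms by (simp add: connectedin_subtopology)
  then have "connected_component_of ?Y x y"
    using assms connected_component_of_def by metis
  moreover have "f y = f x"
    using S assms by auto
  ultimately show ?thesis
    unfolding monotone_part_def by (metis connected_component_of_eq connected_component_of_equiv)
qed

lemma monotone_part_eq_iff: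
  assumes "x \<in> topspace X" "y \<in> topspace X"
  shows "monotone_part X f y = monotone_part X f x \<longleftrightarrow> y \<in> monotone_part X f x"
proof
  show "y \<in> monotone_part X f x" if "monotone_part X f y = monotone_part X f x"
    using monotone_part_self[of y X f] that assms by simp
  have "f constant_on monotone_part X f x"
    using monotone_part_subset[of X f x] by (auto simp: constant_on_def)
  then show "monotone_part X f y = monotone_part X f x" if "y \<in> monotone_part X f x"
    using monotone_part_maximal[OF connectedin_monotone_part that monotone_part_self] assms by blast
qed

lemma continuous_map_monotone_part: "continuous_map X (middle_space X f) (monotone_part X f)"
  by (simp add: quotient_imp_continuous_map quotient_map_monotone_part)

lemma monotone_map_monotone_part: "monotone_map X (middle_space X f) (monotone_part X f)"
  unfolding monotone_map_def topspace_middle_space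
proof (intro conjI ballI subset_refl)
  fix p assume "p \<in> monotone_part X f ` topspace X"
  then obtain x where x: "x \<in> topspace X" "p = monotone_part X f x" by blast
  have "{y \<in> topspace X. monotone_part X f y = p} = monotone_part X f x"
    using x monotone_part_eq_iff[OF x(1)] monotone_part_subset[of X f x] by blast
  then show "connectedin X {y \<in> topspace X. monotone_part X f y = p}"
    by (simp add: connectedin_monotone_part)
qed

lemma compact_space_middle_space: "compact_space X \<Longrightarrow> compact_space (middle_space X f)"
  by (metis compactin_def compact_space_def continuous_map_monotone_part image_compactin
      topspace_middle_space)

text \<open>Different levels are separated by \<lambda>. At one level the fibre is cut between the
  two components, and the cut is thickened to a band of nearby levels.\<close>

lemma Hausdorff_space_middle_space:
  assumes X: "compact_space X" "Hausdorff_space X" and f: "continuous_map X euclideanreal f"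
  shows "Hausdorff_space (middle_space X f)"
  unfolding Hausdorff_space_def topspace_middle_space
proof (intro allI impI, elim conjE imageE)
  fix p q x y
  assume neq: "p \<noteq> q" and p: "p = monotone_part X f x" "x \<in> topspace X"
    and q: "q = monotone_part X f y" "y \<in> topspace X"
  let ?M = "middle_space X f" and ?m = "monotone_part X f"
  have pM: "p \<in> topspace ?M" and qM: "q \<in> topspace ?M"
    using p q by (auto simp: topspace_middle_space)
  show "\<exists>U V. openin ?M U \<and> openin ?M V \<and> p \<in> U \<and> q \<in> V \<and> disjnt U V"
  proof (cases "f x = f y")
    case False
    then obtain A B where AB: "open A" "open B" "f x \<in> A" "f y \<in> B" "A \<inter> B = {}"
      by (meson hausdorff)
    let ?U = "\<lambda>A. {r \<in> topspace ?M. light_part f r \<in> A}"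
    have "openin ?M (?U A)" "openin ?M (?U B)"
      using AB continuous_map_light_part[OF f] by (auto intro: openin_continuous_map_preimage)
    moreover have "p \<in> ?U A" "q \<in> ?U B"
      using pM qM p q AB by (auto simp: light_part_monotone_part)
    moreover have "disjnt (?U A) (?U B)"
      using AB by (auto simp: disjnt_def)
    ultimately show ?thesis by blast
  next
    case True
    let ?F = "{z \<in> topspace X. f z = f x}"
    let ?Y = "subtopology X ?F"
    have cF: "closedin X ?F"
      using closedin_continuous_map_preimage[OF f, of "{f x}"] by simp
    have cY: "compact_space ?Y" and HY: "Hausdorff_space ?Y"
      using X cF by (simp_all add: closedin_compact_space compact_space_subtopology
          Hausdorff_space_subtopology)
    have y: "y \<in> topspace ?Y" using q True by simp
    \<comment> \<open>In the compact Hausdorff fibre a component can be split off from any point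
      outside it by a partition into two closed sets.\<close>
    have "separated_between ?Y p {y}"
    proof (rule separated_between_compact_connected_component)
      show "locally_compact_space ?Y"
        using cY by (simp add: compact_imp_locally_compact_space)
      show pc: "p \<in> connected_components_of ?Y"
        using p by (simp add: monotone_part_def connected_component_in_connected_components_of)
      show "compactin ?Y p"
        using cY pc closedin_compact_space closedin_connected_components_of by blast
      show "closedin ?Y {y}"
        using y HY by (simp add: closedin_Hausdorff_singleton)
      show "disjnt p {y}"
        using monotone_part_eq_iff[OF p(2) q(2), of f] neq p q by (auto simp: disjnt_def)
    qed (fact HY)
    then obtain P Q where PQ: "closedin ?Y P" "closedin ?Y Q" "P \<union> Q = topspace ?Y" "disjnt P Q"
        "p \<subseteq> P" "{y} \<subseteq> Q"
      unfolding separated_between_alt by blast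
    have "closedin X P" "closedin X Q"
      using PQ cF closedin_trans_full by blast+
    moreover have "normal_space X"
      using X by (simp add: compact_Hausdorff_or_regular_imp_normal_space)
    ultimately obtain U V where UV: "openin X U" "openin X V" "P \<subseteq> U" "Q \<subseteq> V" "disjnt U V"
      using PQ(4) unfolding normal_space_def by meson
    \<comment> \<open>\<open>K\<close> is compact and misses the fibre over \<open>f x\<close>, so
      its image is a closed set omitting \<open>f x\<close>. Points with levels outside that image
      form the open set \<open>W\<close>, which lies in \<open>U \<union> V\<close>.\<close>
    define K where "K = topspace X - (U \<union> V)"
    have "closedin X K" using UV by (auto simp: K_def)
    then have "compactin X K" by (simp add: X(1) closedin_compact_space)
    then have "compactin euclideanreal (f ` K)" using f image_compactin by blast
    then have fK: "closedin euclideanreal (f ` K)"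
      by (simp add: compact_imp_closed)
    have fx: "f x \<notin> f ` K"
    proof
      assume "f x \<in> f ` K"
      then obtain z where "z \<in> K" "f z = f x" by auto
      then have "z \<in> P \<union> Q" "z \<notin> U \<union> V" using PQ(3) by (auto simp: K_def)
      then show False using UV by blast
    qed
    define W where "W = topspace X - {z \<in> topspace X. f z \<in> f ` K}"
    have oW: "openin X W"
      unfolding W_def using closedin_continuous_map_preimage[OF f fK] by blast
    have WUV: "W \<subseteq> U \<union> V" by (auto simp: W_def K_def)
    \<comment> \<open>\<open>W\<close> is a union of fibres, so a fibre component that meets
      \<open>A \<inter> W\<close> stays in \<open>U \<union> V\<close> and, being connected, in
      \<open>A\<close>. Hence \<open>U \<inter> W\<close> and \<open>V \<inter> W\<close> are
      saturated and have open images.\<close>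
    have sat: "z' \<in> A \<inter> W"
      if "z \<in> A \<inter> W" "z' \<in> topspace X" "?m z' = ?m z" "A = U \<and> B = V \<or> A = V \<and> B = U" for z z' A B
    proof -
      have zX: "z \<in> topspace X" using that(1) W_def by blast
      have z': "z' \<in> ?m z" using monotone_part_eq_iff[OF zX that(2)] that(3) by blast
      have mW: "?m z \<subseteq> W"
        using that(1) monotone_part_subset[of X f z] by (auto simp: W_def)
      have AB: "openin X A" "openin X B" "?m z \<subseteq> A \<union> B" "A \<inter> B \<inter> ?m z = {}"
        using that(4) UV mW WUV by (auto simp: disjnt_def)
      have "A \<inter> ?m z \<noteq> {}" using that(1) monotone_part_self[OF zX] by blast
      then have "B \<inter> ?m z = {}"
        using connectedinD[OF connectedin_monotone_part[of X f z] AB] by blast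
      moreover have "z' \<in> W" using mW z' by blast
      ultimately show ?thesis using WUV z' that(4) by auto
    qed
    have eq: "{z \<in> topspace X. ?m z \<in> ?m ` (A \<inter> W)} = A \<inter> W"
      if "A = U \<and> B = V \<or> A = V \<and> B = U" for A B
    proof (intro equalityI subsetI)
      fix z assume "z \<in> {z \<in> topspace X. ?m z \<in> ?m ` (A \<inter> W)}"
      then obtain z' where "z' \<in> A \<inter> W" "z \<in> topspace X" "?m z = ?m z'" by blast
      then show "z \<in> A \<inter> W" using sat that by blast
    qed (auto simp: W_def)
    have op: "openin ?M (?m ` (A \<inter> W))" if "A = U \<and> B = V \<or> A = V \<and> B = U" for A B
      unfolding openin_middle_space eq[OF that]
      using that UV oW W_def by (auto simp: openin_Int)
    have "disjnt (?m ` (U \<inter> W)) (?m ` (V \<inter> W))"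
    proof (rule ccontr)
      assume "\<not> ?thesis"
      then obtain z z' where "z \<in> U \<inter> W" "z' \<in> V \<inter> W" "?m z' = ?m z" "z' \<in> topspace X"
        by (auto simp: disjnt_iff W_def)
      then have "z' \<in> U \<inter> W" using sat[of z U z' V] by blast
      then show False using UV(5) \<open>z' \<in> V \<inter> W\<close> by (auto simp: disjnt_iff)
    qed
    moreover have "x \<in> U \<inter> W"
      using PQ(5) UV(3) monotone_part_self[OF p(2), of f] p fx by (auto simp: W_def)
    moreover have "y \<in> V \<inter> W"
      using PQ(6) UV(4) q fx True by (auto simp: W_def)
    ultimately show ?thesis
      using op[of U V] op[of V U] p q by blast
  qed
qed

lemma closed_map_monotone_part:
  assumes "compact_space X" "Hausdorff_space X" "continuous_map X euclideanreal f"
  shows "closed_map X (middle_space X f) (monotone_part X f)"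
  using assms continuous_imp_closed_map continuous_map_monotone_part Hausdorff_space_middle_space
  by blast

lemma connectedin_monotone_part_preimage:
  assumes "compact_space X" "Hausdorff_space X" "continuous_map X euclideanreal f"
    and "connectedin (middle_space X f) S"
  shows "connectedin X {x \<in> topspace X. monotone_part X f x \<in> S}"
  using monotone_closed_map[OF continuous_map_monotone_part closed_map_monotone_part[OF assms(1-3)]]
    monotone_map_monotone_part assms(4) topspace_middle_space by metis

text \<open>The preimage of \<open>S\<close> under the closed monotone quotient map is connected,
  and \<open>f\<close> is constant on it, so it lies in a single component of a fibre.\<close>

lemma light_part_light:
  assumes "compact_space X" "Hausdorff_space X" "continuous_map X euclideanreal f"
    and "connectedin (middle_space X f) S" "light_part f constant_on S" "p \<in> S" "q \<in> S"
  shows "p = q"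
proof -
  have "S \<subseteq> topspace (middle_space X f)" by (simp add: assms(4) connectedin_subset_topspace)
  then obtain x y where xy: "x \<in> topspace X" "y \<in> topspace X" "p = monotone_part X f x"
      "q = monotone_part X f y"
    using assms(6,7) unfolding topspace_middle_space by blast
  have "f constant_on {x \<in> topspace X. monotone_part X f x \<in> S}"
    using assms(5) light_part_monotone_part unfolding constant_on_def
    by (metis (mono_tags, lifting) mem_Collect_eq)
  then show ?thesis
    using monotone_part_maximal[OF connectedin_monotone_part_preimage[OF assms(1-4)]] xy assms(6,7)
    by blast
qed

section \<open>Arc covers\<close>

text \<open>A connected set with two points in a Hausdorff space is perfect, and neighbourhoods of
  limit points contain infinitely many points of the set.\<close>

lemma connectedin_infinite_Int_openin:
  assumes "Hausdorff_space X" "connectedin X S" "x \<in> S" "y \<in> S" "x \<noteq> y" "openin X U" "x \<in> U"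
  shows "infinite (S \<inter> U)"
proof -
  have "\<nexists>a. S = {a}" using assms by blast
  then have "S \<subseteq> X derived_set_of S"
    using assms connectedin_imp_perfect by blast
  then show ?thesis
    using assms by (auto simp: derived_set_of_infinite_openin)
qed

lemma connectedin_finite_eq:
  assumes "Hausdorff_space X" "connectedin X S" "finite S" "x \<in> S" "y \<in> S"
  shows "x = y"
proof (rule ccontr)
  assume "x \<noteq> y"
  moreover have "x \<in> topspace X" using assms connectedin_subset_topspace by blast
  ultimately have "infinite (S \<inter> topspace X)"
    using connectedin_infinite_Int_openin[OF assms(1,2,4,5) _ openin_topspace] by blast
  then show False using assms(3) by simp
qed

text \<open>Each member is also closed, its complement being the union of the others, and a nonempty
  connected clopen set is a component.\<close>

lemma connected_components_of_eq_openin: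
  assumes "\<And>K. K \<in> \<K> \<Longrightarrow> openin X K \<and> connectedin X K \<and> K \<noteq> {}"
    and dis: "pairwise disjnt \<K>" and un: "\<Union>\<K> = topspace X"
  shows "connected_components_of X = \<K>"
proof -
  have clo: "closedin X K" if "K \<in> \<K>" for K
  proof -
    have "topspace X - K = \<Union>(\<K> - {K})"
      using un dis that by (auto simp: pairwise_def disjnt_iff)
    moreover have "openin X (\<Union>(\<K> - {K}))"
      using assms(1) by blast
    ultimately show ?thesis
      using that un by (auto simp: closedin_def)
  qed
  have eq: "C = K" if C: "C \<in> connected_components_of X" and K: "K \<in> \<K>" and "\<not> disjnt C K" for C K
  proof
    show "C \<subseteq> K"
      using that assms(1) clo connectedin_clopen_cases connectedin_connected_components_of by blast
    show "K \<subseteq> C"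
      using that assms(1) connected_components_of_maximal by blast
  qed
  show ?thesis
  proof (intro equalityI subsetI)
    fix C assume C: "C \<in> connected_components_of X"
    obtain x where x: "x \<in> C" using C nonempty_connected_components_of by blast
    then have "x \<in> \<Union>\<K>" using un connected_components_of_subset[OF C] by blast
    then obtain K where K: "K \<in> \<K>" "x \<in> K" by blast
    then have "C = K" using eq[OF C K(1)] x by (auto simp: disjnt_iff)
    then show "C \<in> \<K>" using K by simp
  next
    fix K assume K: "K \<in> \<K>"
    then obtain x where x: "x \<in> K" "x \<in> topspace X" using assms(1) un by blast
    then obtain C where "C \<in> connected_components_of X" "x \<in> C"
      by (metis Union_connected_components_of UnionE)
    moreover from this have "C = K" using eq[OF _ K] x by (auto simp: disjnt_iff)
    ultimately show "K \<in> connected_components_of X" by simp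
  qed
qed

text \<open>On an arc where \<open>l\<close> is injective these are the endpoints; on a set where
  the function is constant every point qualifies.\<close>

definition extremal :: "('a \<Rightarrow> real) \<Rightarrow> 'a set \<Rightarrow> 'a \<Rightarrow> bool" where
  "extremal l A p \<longleftrightarrow> (\<forall>q\<in>A. l q \<le> l p) \<or> (\<forall>q\<in>A. l p \<le> l q)"

definition image_length :: "('a \<Rightarrow> real) \<Rightarrow> 'a set \<Rightarrow> real" where
  "image_length l A = Sup (l ` A) - Inf (l ` A)"

definition arc_cover :: "'a topology \<Rightarrow> ('a \<Rightarrow> real) \<Rightarrow> 'a set set \<Rightarrow> bool" where
  "arc_cover M l \<A> \<longleftrightarrow> finite \<A> \<and> \<Union>\<A> = topspace M \<and>
     (\<forall>A\<in>\<A>. closedin M A \<and> connectedin M A \<and> A \<noteq> {} \<and> inj_on l A) \<and>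
     (\<forall>A\<in>\<A>. \<forall>B\<in>\<A>. A \<noteq> B \<longrightarrow> (\<forall>p\<in>A \<inter> B. extremal l A p))"

lemma image_length_eq:
  assumes "a \<in> A" "b \<in> A" "\<And>q. q \<in> A \<Longrightarrow> l a \<le> l q \<and> l q \<le> l b"
  shows "image_length l A = l b - l a"
proof -
  have "Sup (l ` A) = l b" using assms by (intro cSup_eq_maximum) auto
  moreover have "Inf (l ` A) = l a" using assms by (intro cInf_eq_minimum) auto
  ultimately show ?thesis by (simp add: image_length_def)
qed

text \<open>Only the supremum and the infimum of \<open>l\<close> on \<open>A\<close> can be
  extremal values, and each is attained at most once.\<close>

lemma finite_extremal:
  assumes "inj_on l A"
  shows "finite {p \<in> A. extremal l A p}"
proof (rule finite_imageD)
  have "l ` {p \<in> A. extremal l A p} \<subseteq> {Sup (l ` A), Inf (l ` A)}"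
    unfolding extremal_def by (auto intro: cSup_eq_maximum[symmetric] cInf_eq_minimum[symmetric])
  then show "finite (l ` {p \<in> A. extremal l A p})" by (rule finite_subset) simp
  show "inj_on l {p \<in> A. extremal l A p}" using assms by (rule inj_on_subset) auto
qed

locale compact_Hausdorff_function =
  fixes M :: "'a topology" and l :: "'a \<Rightarrow> real"
  assumes compact: "compact_space M" and Hausdorff: "Hausdorff_space M"
    and cont: "continuous_map M euclideanreal l"
begin

lemma connected_image: "connectedin M A \<Longrightarrow> connected (l ` A)"
  using connectedin_continuous_map_image[OF cont] by simp

lemma compact_image: "closedin M A \<Longrightarrow> compact (l ` A)"
  using image_compactin[OF _ cont] closedin_compact_space[OF compact] by auto

lemma intermediate_value:
  assumes "connectedin M A" "p \<in> A" "q \<in> A" "l p \<le> t" "t \<le> l q"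
  obtains r where "r \<in> A" "l r = t"
proof -
  have "is_interval (l ` A)"
    using connected_image[OF assms(1)] by (simp add: is_interval_connected_1)
  then have "t \<in> l ` A" using assms unfolding is_interval_1 by blast
  then show ?thesis using that by blast
qed

text \<open>Injectivity makes the fibres of \<open>l\<close> on \<open>A\<close> trivially
  connected, and a monotone real function on a connected space pulls intervals back to connected
  sets.\<close>

lemma connectedin_arc_preimage:
  assumes "connectedin M A" "inj_on l A" "is_interval J"
  shows "connectedin M {p \<in> A. l p \<in> J}"
proof -
  have A: "topspace (subtopology M A) = A"
    using connectedin_subset_topspace[OF assms(1)] by auto
  have c: "continuous_map (subtopology M A) euclideanreal l"
    by (simp add: cont continuous_map_from_subtopology)
  have "connected_space (subtopology M A)" "monotone_map (subtopology M A) euclideanreal l"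
    using assms A by (auto simp: connectedin_def intro: injective_imp_monotone_map)
  then have "connectedin (subtopology M A) {p \<in> topspace (subtopology M A). l p \<in> J}"
    using monotone_map_into_euclideanreal_alt[OF c] assms(3) by blast
  then show ?thesis unfolding A by (simp add: connectedin_subtopology)
qed

lemma attains_range:
  assumes "closedin M A" "A \<noteq> {}"
  obtains a b where "a \<in> A" "b \<in> A" "\<And>q. q \<in> A \<Longrightarrow> l a \<le> l q \<and> l q \<le> l b"
proof -
  have "compact (l ` A)" "l ` A \<noteq> {}" using assms compact_image by auto
  then obtain s t where "s \<in> l ` A" "t \<in> l ` A" "\<And>y. y \<in> l ` A \<Longrightarrow> s \<le> y \<and> y \<le> t"
    by (meson compact_attains_inf compact_attains_sup)
  then show ?thesis using that by blast
qed

text \<open>A point at a level strictly between two values is neither a maximum nor a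
  minimum.\<close>

lemma all_extremal_constant:
  assumes "connectedin M A" "\<And>p. p \<in> A \<Longrightarrow> extremal l A p" "p \<in> A" "q \<in> A"
  shows "l p = l q"
proof -
  have False if pq: "p \<in> A" "q \<in> A" "l p < l q" for p q
  proof -
    obtain r where "r \<in> A" "l r = (l p + l q) / 2"
      using intermediate_value[OF assms(1) pq(1,2), of "(l p + l q) / 2"] pq by auto
    then show False using assms(2)[of r] pq unfolding extremal_def by force
  qed
  then show ?thesis using assms by (metis linorder_neqE)
qed

lemma image_length_all_extremal:
  assumes "connectedin M A" "\<And>p. p \<in> A \<Longrightarrow> extremal l A p" "A \<noteq> {}"
  shows "image_length l A = 0"
proof -
  obtain p where p: "p \<in> A" using assms(3) by blast
  have "l p \<le> l q \<and> l q \<le> l p" if "q \<in> A" for q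
    using all_extremal_constant[OF assms(1,2) that p] by simp
  then have "image_length l A = l p - l p"
    by (rule image_length_eq[OF p p])
  then show ?thesis by simp
qed

text \<open>On the compact set \<open>A\<close> the injective \<open>l\<close> is a homeomorphism
  onto its image: the image of \<open>A - U\<close> is closed and omits \<open>l p\<close>.\<close>

lemma arc_relatively_open_image:
  assumes A: "closedin M A" "inj_on l A" and U: "openin M U" and p: "p \<in> A" "p \<in> U"
  obtains e where "e > 0" "\<And>q. q \<in> A \<Longrightarrow> \<bar>l q - l p\<bar> < e \<Longrightarrow> q \<in> U"
proof -
  have "closedin M (A - U)" using A U by (simp add: closedin_diff)
  then have "closed (l ` (A - U))" using compact_image compact_imp_closed by blast
  moreover have "l p \<notin> l ` (A - U)" using A p by (auto dest: inj_onD)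
  ultimately obtain e where "e > 0" "ball (l p) e \<subseteq> - l ` (A - U)"
    by (meson ComplI Compl_iff open_Compl open_contains_ball)
  then show ?thesis
    by (intro that[of e]) (force simp: ball_def dist_real_def abs_minus_commute)+
qed

text \<open>Both arcs take the levels just beyond \<open>l p\<close> on the side \<open>s\<close>.
  Inside \<open>U\<close> the two points at such a level must coincide, and the common point is not
  extremal on \<open>A\<close>, because \<open>l p\<close> and \<open>l qa\<close> lie strictly on
  either side of its level.\<close>

lemma same_side_not_injective:
  assumes A: "closedin M A" "connectedin M A" "inj_on l A"
    and B: "closedin M B" "connectedin M B" "inj_on l B"
    and AB: "\<And>p. p \<in> A \<inter> B \<Longrightarrow> extremal l A p"
    and U: "openin M U" "inj_on l U" and p: "p \<in> A" "p \<in> B" "p \<in> U"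
    and s: "s = 1 \<or> s = -1" and q: "qa \<in> A" "s * l p < s * l qa" "qb \<in> B" "s * l p < s * l qb"
  shows False
proof -
  obtain ea where ea: "ea > 0" "\<And>q. q \<in> A \<Longrightarrow> \<bar>l q - l p\<bar> < ea \<Longrightarrow> q \<in> U"
    using arc_relatively_open_image[OF A(1,3) U(1) p(1,3)] by blast
  obtain eb where eb: "eb > 0" "\<And>q. q \<in> B \<Longrightarrow> \<bar>l q - l p\<bar> < eb \<Longrightarrow> q \<in> U"
    using arc_relatively_open_image[OF B(1,3) U(1) p(2,3)] by blast
  \<comment> \<open>The level \<open>l p + s * d\<close> has to be close enough for both points to
    fall into \<open>U\<close> and to come strictly before \<open>l qa\<close> and
    \<open>l qb\<close>; halving the minimum makes all bounds strict.\<close>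
  define d where "d = Min {ea, eb, s * l qa - s * l p, s * l qb - s * l p} / 2"
  have d: "0 < d" "d < ea" "d < eb" "d < s * l qa - s * l p" "d < s * l qb - s * l p"
    using ea(1) eb(1) q unfolding d_def by (auto simp: min_def)
  define t where "t = l p + s * d"
  have t: "\<bar>t - l p\<bar> = d" using s d by (auto simp: t_def)
  obtain a where a: "a \<in> A" "l a = t"
    using intermediate_value[OF A(2) p(1) q(1), of t] intermediate_value[OF A(2) q(1) p(1), of t]
      s d that unfolding t_def by fastforce
  obtain b where b: "b \<in> B" "l b = t"
    using intermediate_value[OF B(2) p(2) q(3), of t] intermediate_value[OF B(2) q(3) p(2), of t]
      s d that unfolding t_def by fastforce
  have "a \<in> U" "b \<in> U" using a b ea eb t d by auto
  then have "a = b" using U(2) a b by (auto dest: inj_onD)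
  then have "extremal l A a" using AB a b by blast
  then have "l p \<le> t \<and> l qa \<le> t \<or> t \<le> l p \<and> t \<le> l qa"
    using p(1) q(1) a(2) unfolding extremal_def by blast
  then show False
    using s d unfolding t_def by auto
qed

section \<open>Irredundant arc covers and their cores\<close>

context
  fixes \<A>
  assumes cover: "arc_cover M l \<A>"
begin

lemma coverD:
  shows "finite \<A>" "\<Union>\<A> = topspace M"
    and "A \<in> \<A> \<Longrightarrow> closedin M A" "A \<in> \<A> \<Longrightarrow> connectedin M A" "A \<in> \<A> \<Longrightarrow> A \<noteq> {}"
        "A \<in> \<A> \<Longrightarrow> inj_on l A"
    and "\<lbrakk>A \<in> \<A>; B \<in> \<A>; A \<noteq> B; p \<in> A; p \<in> B\<rbrakk> \<Longrightarrow> extremal l A p"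
proof -
  have arc: "\<forall>A\<in>\<A>. closedin M A \<and> connectedin M A \<and> A \<noteq> {} \<and> inj_on l A"
    and ext: "\<forall>A\<in>\<A>. \<forall>B\<in>\<A>. A \<noteq> B \<longrightarrow> (\<forall>p\<in>A \<inter> B. extremal l A p)"
    and fin: "finite \<A>" "\<Union>\<A> = topspace M"
    using cover unfolding arc_cover_def by simp_all
  show "finite \<A>" "\<Union>\<A> = topspace M" by (fact fin)+
  show "closedin M A" "connectedin M A" "A \<noteq> {}" "inj_on l A" if "A \<in> \<A>" using arc that by simp_all
  show "extremal l A p" if "A \<in> \<A>" "B \<in> \<A>" "A \<noteq> B" "p \<in> A" "p \<in> B" using ext that by simp
qed

lemma finite_fibre: "finite {p \<in> topspace M. l p = y}"
proof -
  have "{p \<in> topspace M. l p = y} = (\<Union>A\<in>\<A>. {p \<in> A. l p = y})"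
    using coverD(2) by blast
  moreover have "finite {p \<in> A. l p = y}" if "A \<in> \<A>" for A
  proof (rule finite_subset)
    show "{p \<in> A. l p = y} \<subseteq> {the_inv_into A l y}"
      using coverD(6)[OF that] by (auto simp: the_inv_into_f_f)
  qed simp
  ultimately show ?thesis using coverD(1) by simp
qed

text \<open>Each arc meets a level at most once, so fibres are finite, and a finite connected set
  has at most one point. Local monotonicity thus amounts to local injectivity.\<close>

lemma monotone_imp_injective:
  assumes "N \<subseteq> topspace M" "monotone_map (subtopology M N) euclideanreal l"
  shows "inj_on l N"
proof (rule inj_onI)
  fix p q assume pq: "p \<in> N" "q \<in> N" "l p = l q"
  let ?S = "{x \<in> topspace (subtopology M N). l x = l p}"
  have "connectedin M ?S"
    using assms(2) unfolding monotone_map_def by (auto simp: connectedin_subtopology)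
  moreover have "finite ?S"
    by (rule finite_subset[OF _ finite_fibre[of "l p"]]) auto
  ultimately show "p = q"
    using connectedin_finite_eq[OF Hausdorff, of ?S p q] pq assms(1) by auto
qed

text \<open>Removing the other arcs costs \<open>A\<close> only extremal points, at most its two
  ends. In a fully reduced cover the cores are the components of the locally monotone set.\<close>

definition core :: "'a set \<Rightarrow> 'a set" where
  "core A = A - \<Union>(\<A> - {A})"

lemma core_subset: "core A \<subseteq> A" by (auto simp: core_def)

lemma openin_core:
  assumes "A \<in> \<A>" shows "openin M (core A)"
proof -
  have "core A = topspace M - \<Union>(\<A> - {A})"
    using coverD(2) assms by (auto simp: core_def)
  moreover have "closedin M (\<Union>(\<A> - {A}))"
    using coverD by (intro closedin_Union) auto
  ultimately show ?thesis by (simp add: openin_diff)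
qed

lemma not_extremal_core: "A \<in> \<A> \<Longrightarrow> p \<in> A \<Longrightarrow> \<not> extremal l A p \<Longrightarrow> p \<in> core A"
  unfolding core_def using coverD(7)[of A _ p] by blast

text \<open>A level strictly between two values on the core is attained at a nonextremal point of
  \<open>A\<close>, which no other arc contains. So the core is the part of \<open>A\<close> over an
  interval.\<close>

lemma connectedin_core:
  assumes A: "A \<in> \<A>" shows "connectedin M (core A)"
proof -
  have "is_interval (l ` core A)"
    unfolding is_interval_1
  proof (intro ballI allI impI)
    fix s t u assume st: "s \<in> l ` core A" "t \<in> l ` core A" and u: "s \<le> u \<and> u \<le> t"
    then obtain p q where pq: "p \<in> core A" "q \<in> core A" "s = l p" "t = l q" by blast
    show "u \<in> l ` core A"
    proof (cases "u = s \<or> u = t")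
      case False
      obtain r where r: "r \<in> A" "l r = u"
        using intermediate_value[OF coverD(4)[OF A], of p q u] pq u core_subset by auto
      then have "\<not> extremal l A r"
        using pq u False core_subset[of A] unfolding extremal_def by fastforce
      then show ?thesis using not_extremal_core[OF A r(1)] r by blast
    qed (use st in auto)
  qed
  moreover have "{p \<in> A. l p \<in> l ` core A} = core A"
  proof (intro equalityI subsetI)
    fix p assume "p \<in> {p \<in> A. l p \<in> l ` core A}"
    then obtain q where "p \<in> A" "q \<in> core A" "l p = l q" by blast
    then show "p \<in> core A" using coverD(6)[OF A] core_subset[of A] by (metis inj_onD subsetD)
  qed (use core_subset[of A] in auto)
  ultimately show ?thesis
    using connectedin_arc_preimage[OF coverD(4)[OF A] coverD(6)[OF A], of "l ` core A"] by simp
qed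

text \<open>A one-point arc lies in no other arc by irredundancy and is its own core. A larger arc
  has infinitely many points near each of its points, only finitely many of them extremal.\<close>

lemma closure_core:
  assumes irr: "\<And>A B. A \<in> \<A> \<Longrightarrow> B \<in> \<A> \<Longrightarrow> A \<subseteq> B \<Longrightarrow> A = B" and A: "A \<in> \<A>"
  shows "M closure_of core A = A"
proof
  show "M closure_of core A \<subseteq> A"
    using closure_of_minimal[OF core_subset coverD(3)[OF A]] .
  show "A \<subseteq> M closure_of core A"
  proof
    fix p assume p: "p \<in> A"
    have pM: "p \<in> topspace M" using p A coverD(2) by blast
    show "p \<in> M closure_of core A"
    proof (cases "A = {p}")
      case True
      then have "p \<notin> B" if "B \<in> \<A> - {A}" for B using irr[OF A, of B] that by blast
      then have "p \<in> core A" using p by (auto simp: core_def)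
      then show ?thesis using pM by (auto simp: in_closure_of)
    next
      case False
      then obtain q where q: "q \<in> A" "p \<noteq> q" using p by blast
      show ?thesis
        unfolding in_closure_of
      proof (intro conjI allI impI)
        fix U assume U: "p \<in> U \<and> openin M U"
        then have "infinite (A \<inter> U)"
          using connectedin_infinite_Int_openin[OF Hausdorff coverD(4)[OF A] p q] by blast
        then have "infinite (A \<inter> U - {p \<in> A. extremal l A p})"
          using finite_extremal[OF coverD(6)[OF A]] by simp
        then obtain r where "r \<in> A" "r \<in> U" "\<not> extremal l A r"
          using infinite_imp_nonempty by blast
        then show "\<exists>y. y \<in> core A \<and> y \<in> U" using not_extremal_core[OF A] by blast
      qed (fact pM)
    qed
  qed
qed

text \<open>At a shared point each arc leaves upwards or downwards, and injectivity nearby allows at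
  most one arc per direction. So exactly two arcs meet there, one at its top and one at its bottom,
  the configuration for which \<open>red\<close> demands a third arc.\<close>

lemma locally_monotone_points_reduced:
  assumes irr: "\<And>A B. A \<in> \<A> \<Longrightarrow> B \<in> \<A> \<Longrightarrow> A \<subseteq> B \<Longrightarrow> A = B"
    and red: "\<And>A B p. \<lbrakk>A \<in> \<A>; B \<in> \<A>; A \<noteq> B; p \<in> A; p \<in> B; \<forall>q\<in>A. l q \<le> l p; \<forall>q\<in>B. l p \<le> l q\<rbrakk>
                \<Longrightarrow> \<exists>C\<in>\<A> - {A, B}. p \<in> C"
  shows "locally_monotone_points M l = \<Union>(core ` \<A>)"
proof (intro equalityI subsetI)
  fix p assume "p \<in> \<Union>(core ` \<A>)"
  then obtain A where A: "A \<in> \<A>" "p \<in> core A" by blast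
  have "core A \<subseteq> topspace M" using A(1) openin_core openin_subset by blast
  moreover have "monotone_map (subtopology M (core A)) euclideanreal l"
    using coverD(6)[OF A(1)] core_subset[of A]
    by (intro injective_imp_monotone_map) (auto intro: inj_on_subset)
  ultimately show "p \<in> locally_monotone_points M l"
    using A openin_core[OF A(1)] unfolding locally_monotone_points_def locally_monotone_at_def
    by blast
next
  fix p assume "p \<in> locally_monotone_points M l"
  then obtain N U where N: "openin M U" "p \<in> U" "U \<subseteq> N" "N \<subseteq> topspace M"
      "monotone_map (subtopology M N) euclideanreal l" and pM: "p \<in> topspace M"
    unfolding locally_monotone_points_def locally_monotone_at_def by auto
  have injU: "inj_on l U" using monotone_imp_injective[OF N(4,5)] N(3) inj_on_subset by blast
  show "p \<in> \<Union>(core ` \<A>)"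
  proof (rule ccontr)
    assume no: "p \<notin> \<Union>(core ` \<A>)"
    obtain A where A: "A \<in> \<A>" "p \<in> A" using pM coverD(2) by blast
    then obtain B where B: "B \<in> \<A>" "p \<in> B" "A \<noteq> B" using no by (auto simp: core_def)
    have side: False if "C \<in> \<A>" "D \<in> \<A>" "C \<noteq> D" "p \<in> C" "p \<in> D" "s = 1 \<or> s = -1"
      "qa \<in> C" "s * l p < s * l qa" "qb \<in> D" "s * l p < s * l qb" for C D s qa qb
    proof (rule same_side_not_injective[of C D U p s qa qb])
      show "\<And>r. r \<in> C \<inter> D \<Longrightarrow> extremal l C r" using coverD(7) that by blast
    qed (use coverD that N injU in auto)
    have up_down: "(\<exists>q\<in>C. l p < l q) \<or> (\<exists>q\<in>C. l q < l p)" if C: "C \<in> \<A>" "p \<in> C" for C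
    proof -
      obtain D where D: "D \<in> \<A>" "p \<in> D" "C \<noteq> D" using A B C by metis
      then have "C \<noteq> {p}" using irr[of C D] C by blast
      then obtain q where "q \<in> C" "q \<noteq> p" using C by blast
      then have "l q \<noteq> l p" using coverD(6)[OF C(1)] C by (auto dest: inj_onD)
      then show ?thesis using \<open>q \<in> C\<close> by (meson linorder_neqE)
    qed
    have up: "\<not> ((\<exists>q\<in>C. l p < l q) \<and> (\<exists>q\<in>D. l p < l q))"
      if "C \<in> \<A>" "D \<in> \<A>" "C \<noteq> D" "p \<in> C" "p \<in> D" for C D
      using side[OF that, of 1] by auto
    have down: "\<not> ((\<exists>q\<in>C. l q < l p) \<and> (\<exists>q\<in>D. l q < l p))"
      if "C \<in> \<A>" "D \<in> \<A>" "C \<noteq> D" "p \<in> C" "p \<in> D" for C D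
      using side[OF that, of "-1"] by auto
    \<comment> \<open>If \<open>C\<close> has its top at \<open>p\<close>, then \<open>D\<close> has
      its bottom there, and no direction is left for the third arc.\<close>
    have fin: False if CD: "C \<in> \<A>" "D \<in> \<A>" "C \<noteq> D" "p \<in> C" "p \<in> D"
      "\<not> (\<exists>q\<in>C. l p < l q)" for C D
    proof -
      have "\<exists>q\<in>C. l q < l p" using up_down CD by blast
      then have "\<not> (\<exists>q\<in>D. l q < l p)" using down CD by blast
      then obtain E where E: "E \<in> \<A>" "E \<noteq> C" "E \<noteq> D" "p \<in> E"
        using red[of C D p] CD by (auto simp: not_less)
      then show False using up_down up down CD by metis
    qed
    show False
      using fin[of A B] fin[of B A] up[of A B] A B by blast
  qed
qed

lemma connected_components_reduced:
  assumes irr: "\<And>A B. A \<in> \<A> \<Longrightarrow> B \<in> \<A> \<Longrightarrow> A \<subseteq> B \<Longrightarrow> A = B"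
    and L: "locally_monotone_points M l = \<Union>(core ` \<A>)"
  shows "connected_components_of (subtopology M (locally_monotone_points M l)) = core ` \<A>"
proof (rule connected_components_of_eq_openin)
  have LM: "topspace (subtopology M (locally_monotone_points M l)) = \<Union>(core ` \<A>)"
    unfolding L[symmetric] by (auto simp: locally_monotone_points_def)
  then show "\<Union>(core ` \<A>) = topspace (subtopology M (locally_monotone_points M l))" ..
  fix K assume "K \<in> core ` \<A>"
  then obtain A where A: "A \<in> \<A>" "K = core A" by blast
  have "core A \<noteq> {}"
    using closure_core[OF irr A(1)] coverD(5)[OF A(1)] by force
  then show "openin (subtopology M (locally_monotone_points M l)) K \<and>
      connectedin (subtopology M (locally_monotone_points M l)) K \<and> K \<noteq> {}"
    using A openin_core[OF A(1)] connectedin_core[OF A(1)]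
    by (auto simp: L connectedin_subtopology openin_subtopology)
next
  show "pairwise disjnt (core ` \<A>)"
    by (auto simp: pairwise_def disjnt_iff core_def)
qed

end

end

section \<open>Reducing an arc cover by deletion and merging\<close>

context compact_Hausdorff_function
begin

text \<open>Every point of \<open>A\<close> lies in \<open>B\<close>, so is extremal on
  \<open>A\<close>; hence \<open>l\<close> is constant on \<open>A\<close> and its length is
  0.\<close>

lemma arc_cover_remove:
  assumes c: "arc_cover M l \<A>" and AB: "A \<in> \<A>" "B \<in> \<A>" "A \<subseteq> B" "A \<noteq> B"
  shows "arc_cover M l (\<A> - {A})"
    and "sum (image_length l) (\<A> - {A}) = sum (image_length l) \<A>"
proof -
  have "\<Union>(\<A> - {A}) = \<Union>\<A>" using AB by blast
  then show "arc_cover M l (\<A> - {A})"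
    using c unfolding arc_cover_def by (simp, blast)
  have "extremal l A p" if "p \<in> A" for p
    using coverD(7)[OF c AB(1,2,4)] that AB(3) by blast
  then have "image_length l A = 0"
    using image_length_all_extremal coverD(4,5)[OF c AB(1)] by blast
  then show "sum (image_length l) (\<A> - {A}) = sum (image_length l) \<A>"
    using sum.remove[OF coverD(1)[OF c] AB(1), of "image_length l"] by simp
qed

text \<open>The levels of \<open>A\<close> end at \<open>l p\<close> where those of \<open>B\<close>
  begin, so the union is again an arc and lengths add. By \<open>only\<close>, any other arc meets
  the union away from \<open>p\<close>, at the lower end of \<open>A\<close> or the upper end of
  \<open>B\<close>, and these remain ends of the union.\<close>

lemma arc_cover_merge:
  assumes c: "arc_cover M l \<A>" and AB: "A \<in> \<A>" "B \<in> \<A>" "A \<noteq> B" "p \<in> A" "p \<in> B"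
    and top: "\<forall>q\<in>A. l q \<le> l p" and bot: "\<forall>q\<in>B. l p \<le> l q"
    and only: "\<forall>C\<in>\<A> - {A, B}. p \<notin> C"
  defines "\<B> \<equiv> insert (A \<union> B) (\<A> - {A, B})"
  shows "arc_cover M l \<B>" and "card \<B> < card \<A>"
    and "sum (image_length l) \<B> = sum (image_length l) \<A>"
proof -
  note cD = coverD[OF c]
  have injA: "q = p" if "q \<in> A" "l q = l p" for q
    using cD(6)[OF AB(1)] that AB(4) by (auto dest: inj_onD)
  have injB: "q = p" if "q \<in> B" "l q = l p" for q
    using cD(6)[OF AB(2)] that AB(5) by (auto dest: inj_onD)
  have inj: "inj_on l (A \<union> B)"
  proof (rule inj_onI)
    have cross: "x = y" if "x \<in> A" "y \<in> B" "l x = l y" for x y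
    proof -
      have "l x = l p" "l y = l p" using top bot that by (metis order_antisym)+
      then show ?thesis using injA injB that by blast
    qed
    fix x y assume "x \<in> A \<union> B" "y \<in> A \<union> B" "l x = l y"
    then consider "x \<in> A" "y \<in> A" | "x \<in> B" "y \<in> B" | "x \<in> A" "y \<in> B" | "y \<in> A" "x \<in> B"
      by blast
    then show "x = y"
      using cross \<open>l x = l y\<close> inj_onD[OF cD(6)[OF AB(1)]] inj_onD[OF cD(6)[OF AB(2)]]
      by cases metis+
  qed
  have extC: "extremal l C q" "extremal l (A \<union> B) q"
    if C: "C \<in> \<A> - {A, B}" and q: "q \<in> C" "q \<in> A \<union> B" for C q
  proof -
    have "q \<noteq> p" using only C q by blast
    show "extremal l C q" using cD(7)[of C A q] cD(7)[of C B q] AB C q by blast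
    show "extremal l (A \<union> B) q"
    proof (cases "q \<in> A")
      case True
      then have "extremal l A q" using cD(7)[of A C q] AB C q by blast
      moreover have "l q < l p" using injA[OF True] \<open>q \<noteq> p\<close> top True by fastforce
      ultimately have "\<forall>r\<in>A. l q \<le> l r" using AB(4) unfolding extremal_def by force
      moreover have "\<forall>r\<in>B. l q \<le> l r" using bot \<open>l q < l p\<close> by fastforce
      ultimately show ?thesis unfolding extremal_def by blast
    next
      case False
      then have qB: "q \<in> B" using q by blast
      then have "extremal l B q" using cD(7)[of B C q] AB C q by blast
      moreover have "l p < l q" using injB[OF qB] \<open>q \<noteq> p\<close> bot qB by fastforce
      ultimately have "\<forall>r\<in>B. l r \<le> l q" using AB(5) unfolding extremal_def by force
      moreover have "\<forall>r\<in>A. l r \<le> l q" using top \<open>l p < l q\<close> by fastforce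
      ultimately show ?thesis unfolding extremal_def by blast
    qed
  qed
  show "arc_cover M l \<B>"
    unfolding arc_cover_def
  proof (intro conjI ballI impI)
    show "finite \<B>" using cD(1) by (simp add: \<B>_def)
    show "\<Union>\<B> = topspace M" using cD(2) AB by (auto simp: \<B>_def)
    show "closedin M E" "E \<noteq> {}" "inj_on l E" if "E \<in> \<B>" for E
      using that cD(3,5,6) AB inj by (auto simp: \<B>_def)
    have "connectedin M (A \<union> B)"
      using connectedin_Un cD(4) AB by blast
    then show "connectedin M E" if "E \<in> \<B>" for E
      using that cD(4) by (auto simp: \<B>_def)
    show "extremal l E q" if E: "E \<in> \<B>" "E' \<in> \<B>" "E \<noteq> E'" "q \<in> E \<inter> E'" for E E' q
    proof (cases "E = A \<union> B")
      case True
      then have "E' \<in> \<A> - {A, B}" using E by (auto simp: \<B>_def)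
      then show ?thesis using extC(2)[of E' q] E True by blast
    next
      case False
      then have E1: "E \<in> \<A> - {A, B}" using E by (auto simp: \<B>_def)
      show ?thesis
      proof (cases "E' = A \<union> B")
        case True
        then show ?thesis using extC(1)[OF E1, of q] E by blast
      next
        case False
        then have "E' \<in> \<A>" using E by (auto simp: \<B>_def)
        then show ?thesis using cD(7)[of E E' q] E E1 by blast
      qed
    qed
  qed
  have new: "A \<union> B \<notin> \<A> - {A, B}" using only AB by blast
  have fin: "finite (\<A> - {A, B})" using cD(1) by simp
  have A2: "\<A> = insert A (insert B (\<A> - {A, B}))" using AB by blast
  have "card \<A> = Suc (Suc (card (\<A> - {A, B})))"
    using AB(3) fin by (subst A2) simp
  moreover have "card \<B> = Suc (card (\<A> - {A, B}))"
    using new fin by (simp add: \<B>_def)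
  ultimately show "card \<B> < card \<A>" by simp
  obtain a b where a: "a \<in> A" "\<And>q. q \<in> A \<Longrightarrow> l a \<le> l q \<and> l q \<le> l b" "b \<in> A"
    using attains_range[OF cD(3,5)[OF AB(1)]] by metis
  obtain a' b' where b: "b' \<in> B" "\<And>q. q \<in> B \<Longrightarrow> l a' \<le> l q \<and> l q \<le> l b'" "a' \<in> B"
    using attains_range[OF cD(3,5)[OF AB(2)]] by metis
  have "image_length l A = l p - l a"
    using image_length_eq[of a A p l] a top AB by blast
  moreover have "image_length l B = l b' - l p"
    using image_length_eq[of p B b' l] b bot AB by blast
  moreover have "l a \<le> l q \<and> l q \<le> l b'" if "q \<in> A \<union> B" for q
    using that a b top bot AB by (metis Un_iff order_trans)
  then have "image_length l (A \<union> B) = l b' - l a"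
    using image_length_eq[of a "A \<union> B" b' l] a b by blast
  ultimately have "image_length l (A \<union> B) = image_length l A + image_length l B" by simp
  moreover have "sum (image_length l) \<A>
      = image_length l A + image_length l B + sum (image_length l) (\<A> - {A, B})"
    using AB(3) fin by (subst A2) simp
  ultimately show "sum (image_length l) \<B> = sum (image_length l) \<A>"
    using new fin by (simp add: \<B>_def)
qed

text \<open>Merging arcs at vertices where the function is locally monotone, and discarding redundant
  one-point arcs, leads to a cover whose members are exactly the edges.\<close>

lemma arc_cover_edges:
  assumes "arc_cover M l \<A>"
  defines "L \<equiv> locally_monotone_points M l"
  shows "M closure_of L = topspace M" "finite (connected_components_of (subtopology M L))"
    "K \<in> connected_components_of (subtopology M L) \<Longrightarrow>
       monotone_map (subtopology M (M closure_of K)) euclideanreal l"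
    "sum (image_length l) (edges M l) = sum (image_length l) \<A>"
proof -
  define mergeable where "mergeable \<A> A B p \<longleftrightarrow> A \<in> \<A> \<and> B \<in> \<A> \<and> A \<noteq> B \<and> p \<in> A \<and> p \<in> B \<and>
      (\<forall>q\<in>A. l q \<le> l p) \<and> (\<forall>q\<in>B. l p \<le> l q) \<and> (\<forall>C\<in>\<A> - {A, B}. p \<notin> C)" for \<A> A B p
  have "\<exists>\<B>. arc_cover M l \<B> \<and> sum (image_length l) \<B> = sum (image_length l) \<A> \<and>
      (\<forall>A\<in>\<B>. \<forall>B\<in>\<B>. A \<subseteq> B \<longrightarrow> A = B) \<and> (\<forall>A B p. \<not> mergeable \<B> A B p)"
    using assms(1)
  \<comment> \<open>Deletion and merging both lower the number of members, so the reduction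
    terminates.\<close>
  proof (induction "card \<A>" arbitrary: \<A> rule: less_induct)
    case less
    show ?case
    proof (cases "\<forall>A\<in>\<A>. \<forall>B\<in>\<A>. A \<subseteq> B \<longrightarrow> A = B")
      case False
      then obtain A B where AB: "A \<in> \<A>" "B \<in> \<A>" "A \<subseteq> B" "A \<noteq> B" by blast
      have "card (\<A> - {A}) < card \<A>"
        using AB(1) coverD(1)[OF less.prems] by (intro card_Diff1_less)
      from less.hyps[OF this arc_cover_remove(1)[OF less.prems AB]]
      show ?thesis unfolding arc_cover_remove(2)[OF less.prems AB] .
    next
      case irr: True
      show ?thesis
      proof (cases "\<forall>A B p. \<not> mergeable \<A> A B p")
        case True
        with irr less.prems show ?thesis by (intro exI[of _ \<A>] conjI) simp_all
      next
        case False
        then obtain A B p where "mergeable \<A> A B p" by blast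
        then have AB: "A \<in> \<A>" "B \<in> \<A>" "A \<noteq> B" "p \<in> A" "p \<in> B"
            "\<forall>q\<in>A. l q \<le> l p" "\<forall>q\<in>B. l p \<le> l q" "\<forall>C\<in>\<A> - {A, B}. p \<notin> C"
          unfolding mergeable_def by simp_all
        note m = arc_cover_merge[OF less.prems AB]
        from less.hyps[OF m(2,1)] show ?thesis unfolding m(3) .
      qed
    qed
  qed
  then obtain \<B> where \<B>: "arc_cover M l \<B>" "sum (image_length l) \<B> = sum (image_length l) \<A>"
    and irr': "\<forall>A\<in>\<B>. \<forall>B\<in>\<B>. A \<subseteq> B \<longrightarrow> A = B" and red': "\<forall>A B p. \<not> mergeable \<B> A B p"
    by (elim exE conjE)
  have irr: "A = B" if "A \<in> \<B>" "B \<in> \<B>" "A \<subseteq> B" for A B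
    using irr' that by simp
  have red: "\<exists>C\<in>\<B> - {A, B}. p \<in> C"
    if "A \<in> \<B>" "B \<in> \<B>" "A \<noteq> B" "p \<in> A" "p \<in> B" "\<forall>q\<in>A. l q \<le> l p" "\<forall>q\<in>B. l p \<le> l q" for A B p
    using red'[rule_format, of A B p] that unfolding mergeable_def by simp
  let ?core = "core \<B>"
  have L: "L = \<Union>(?core ` \<B>)"
    unfolding L_def by (rule locally_monotone_points_reduced[OF \<B>(1) irr red])
  have comps: "connected_components_of (subtopology M L) = ?core ` \<B>"
    unfolding L_def by (rule connected_components_reduced[OF \<B>(1) irr L[unfolded L_def]])
  have cl: "M closure_of ?core A = A" if "A \<in> \<B>" for A
    by (rule closure_core[OF \<B>(1) irr that])
  have "edges M l = \<B>"
    unfolding edges_def L_def[symmetric] comps image_image using cl by simp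
  then show "sum (image_length l) (edges M l) = sum (image_length l) \<A>" using \<B>(2) by simp
  show "finite (connected_components_of (subtopology M L))"
    unfolding comps using coverD(1)[OF \<B>(1)] by simp
  show "monotone_map (subtopology M (M closure_of K)) euclideanreal l"
    if "K \<in> connected_components_of (subtopology M L)"
  proof -
    obtain A where "A \<in> \<B>" "K = ?core A" using \<open>K \<in> _\<close> comps by blast
    then have "M closure_of K \<in> \<B>" using cl by simp
    then show ?thesis
      using coverD(6)[OF \<B>(1)] by (intro injective_imp_monotone_map) (auto intro: inj_on_subset)
  qed
  show "M closure_of L = topspace M"
  proof
    show "topspace M \<subseteq> M closure_of L"
    proof
      fix p assume "p \<in> topspace M"
      then obtain A where A: "A \<in> \<B>" "p \<in> A" using coverD(2)[OF \<B>(1)] by blast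
      then have "p \<in> M closure_of ?core A" using cl by simp
      moreover have "?core A \<subseteq> L" using L A by blast
      ultimately show "p \<in> M closure_of L" using closure_of_mono by blast
    qed
  qed (rule closure_of_subset_topspace)
qed

end

lemma compact_Hausdorff_function_middle_space:
  assumes "compact_Hausdorff_function X f"
  shows "compact_Hausdorff_function (middle_space X f) (light_part f)"
  using assms unfolding compact_Hausdorff_function_def
  by (simp add: compact_space_middle_space Hausdorff_space_middle_space continuous_map_light_part)

text \<open>The point at issue is how edges meet. If \<open>p\<close> is not extremal on the closure
  of \<open>K\<close>, then \<open>K\<close> itself takes values on both sides of
  \<open>l p\<close>, hence the value \<open>l p\<close>. Injectivity on the closure puts
  \<open>p\<close> in \<open>K\<close>, but the open set \<open>K\<close> misses the closure of any
  other component.\<close>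

lemma piecewise_monotone_edges:
  assumes "compact_Hausdorff_function X f" and pm: "piecewise_monotone X f"
  defines "M \<equiv> middle_space X f" and "l \<equiv> light_part f"
  shows "arc_cover M l (edges M l)"
proof -
  interpret X: compact_Hausdorff_function X f by fact
  interpret M: compact_Hausdorff_function M l
    unfolding M_def l_def by (rule compact_Hausdorff_function_middle_space) fact
  define L where "L = locally_monotone_points M l"
  define \<K> where "\<K> = connected_components_of (subtopology M L)"
  have cl: "M closure_of L = topspace M" and fin: "finite \<K>"
    and mon: "\<And>K. K \<in> \<K> \<Longrightarrow> monotone_map (subtopology M (M closure_of K)) euclideanreal l"
    using pm unfolding piecewise_monotone_def Let_def M_def l_def L_def \<K>_def by blast+
  have E: "edges M l = (\<lambda>K. M closure_of K) ` \<K>"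
    by (simp add: edges_def L_def \<K>_def)
  have sub: "L \<subseteq> topspace M" by (auto simp: L_def locally_monotone_points_def)
  have "openin M L"
  proof (subst openin_subopen, intro ballI)
    fix p assume "p \<in> L"
    then obtain N U where NU: "openin M U" "p \<in> U" "U \<subseteq> N" "N \<subseteq> topspace M"
        "monotone_map (subtopology M N) euclideanreal l"
      unfolding L_def locally_monotone_points_def locally_monotone_at_def by blast
    then have "U \<subseteq> L"
      unfolding L_def locally_monotone_points_def locally_monotone_at_def by blast
    then show "\<exists>T. openin M T \<and> p \<in> T \<and> T \<subseteq> L" using NU by blast
  qed
  have \<K>: "openin M K" "connectedin M K" "K \<noteq> {}" "K \<subseteq> topspace M" if "K \<in> \<K>" for K
  proof -
    \<comment> \<open>Openness of a component in \<open>L\<close> comes from there being only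
      finitely many.\<close>
    have "openin (subtopology M L) K"
      using that fin open_in_finite_connected_components unfolding \<K>_def by blast
    then show "openin M K" using \<open>openin M L\<close> openin_trans_full by blast
    then show "K \<subseteq> topspace M" by (rule openin_subset)
    show "connectedin M K"
      using that connectedin_connected_components_of[of K "subtopology M L"]
      by (simp add: \<K>_def connectedin_subtopology)
    show "K \<noteq> {}" using that nonempty_connected_components_of unfolding \<K>_def by blast
  qed
  \<comment> \<open>Monotonicity makes the fibres in the closure connected, and lightness reduces
    them to points.\<close>
  have inj: "inj_on l (M closure_of K)" if K: "K \<in> \<K>" for K
  proof (rule inj_onI)
    fix p q assume pq: "p \<in> M closure_of K" "q \<in> M closure_of K" "l p = l q"
    let ?S = "{x \<in> topspace (subtopology M (M closure_of K)). l x = l p}"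
    have "connectedin M ?S"
      using mon[OF K] unfolding monotone_map_def by (auto simp: connectedin_subtopology)
    moreover have "l constant_on ?S" by (auto simp: constant_on_def)
    moreover have "p \<in> ?S" "q \<in> ?S"
      using pq closure_of_subset_topspace[of M K] by auto
    ultimately show "p = q"
      using light_part_light[OF X.compact X.Hausdorff X.cont] unfolding M_def l_def by blast
  qed
  show ?thesis
    unfolding arc_cover_def
  proof (intro conjI ballI impI)
    show "finite (edges M l)" using fin E by simp
    have "\<Union>\<K> = L" using sub by (simp add: \<K>_def Union_connected_components_of inf.absorb2)
    then show "\<Union>(edges M l) = topspace M"
      using cl closure_of_Union[OF fin, of M] unfolding E by simp
    show "closedin M A" "connectedin M A" "inj_on l A" if "A \<in> edges M l" for A
      using that \<K> inj unfolding E by (auto intro: connectedin_closure_of)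
    show "A \<noteq> {}" if A: "A \<in> edges M l" for A
    proof -
      obtain K where "K \<in> \<K>" "A = M closure_of K" using A unfolding E by blast
      then show ?thesis using \<K>(3,4)[of K] closure_of_subset[of K M] by blast
    qed
    show "extremal l A p" if AB: "A \<in> edges M l" "B \<in> edges M l" "A \<noteq> B" "p \<in> A \<inter> B" for A B p
    proof (rule ccontr)
      assume ne: "\<not> extremal l A p"
      obtain K J where K: "K \<in> \<K>" "A = M closure_of K" and J: "J \<in> \<K>" "B = M closure_of J"
        using AB(1,2) unfolding E by blast
      have "K \<noteq> J" using AB(3) K J by blast
      then have "K \<inter> J = {}"
        using K(1) J(1) connected_components_of_overlap[of K _ J] unfolding \<K>_def by blast
      then have "K \<inter> B = {}"
        using \<K>(1)[OF K(1)] J(2) openin_Int_closure_of_eq_empty[of M K J] by simp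
      then have pK: "p \<notin> K" "p \<in> A" using AB(4) by auto
      obtain a b where ab: "a \<in> A" "l a < l p" "b \<in> A" "l p < l b"
        using ne unfolding extremal_def by (auto simp: not_le)
      let ?V = "\<lambda>V. {x \<in> topspace M. l x \<in> V}"
      have meets: "\<exists>x\<in>K. l x \<in> V" if "open V" "c \<in> A" "l c \<in> V" for V c
      proof -
        have "openin M (?V V)"
          using that(1) by (intro openin_continuous_map_preimage[OF M.cont]) simp
        moreover have c: "c \<in> M closure_of K" using that(2) K(2) by simp
        moreover have "c \<in> ?V V" using c that(3) by (simp add: in_closure_of)
        ultimately obtain y where "y \<in> K" "y \<in> ?V V" unfolding in_closure_of by metis
        then show ?thesis by blast
      qed
      obtain a' where a': "a' \<in> K" "l a' < l p"
        using meets[of "{..<l p}" a] ab by (auto simp only: open_lessThan lessThan_iff)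
      obtain b' where b': "b' \<in> K" "l p < l b'"
        using meets[of "{l p<..}" b] ab by (auto simp only: open_greaterThan greaterThan_iff)
      obtain r where "r \<in> K" "l r = l p"
        using M.intermediate_value[OF \<K>(2)[OF K(1)] a'(1) b'(1), of "l p"] a' b' by auto
      moreover have "r \<in> A" using \<open>r \<in> K\<close> K closure_of_subset[OF \<K>(4)[OF K(1)]] by blast
      ultimately show False using inj[OF K(1)] pK K(2) by (metis inj_onD)
    qed
  qed
qed

section \<open>Monotone covers and total variation\<close>

text \<open>The counterpart of an arc cover before passing to the middle space: connected fibres
  replace injectivity, so the function may be constant on a member. The family is indexed because
  different members can have the same image in the middle space.\<close>

definition monotone_cover :: "'a topology \<Rightarrow> ('a \<Rightarrow> real) \<Rightarrow> 'j set \<Rightarrow> ('j \<Rightarrow> 'a set) \<Rightarrow> bool" where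
  "monotone_cover X f J A \<longleftrightarrow> finite J \<and> (\<Union>j\<in>J. A j) = topspace X \<and>
     (\<forall>j\<in>J. closedin X (A j) \<and> connectedin X (A j) \<and> A j \<noteq> {} \<and>
        (\<forall>y. connectedin X {x \<in> A j. f x = y})) \<and>
     (\<forall>j\<in>J. \<forall>k\<in>J. j \<noteq> k \<longrightarrow> (\<forall>x\<in>A j \<inter> A k. extremal f (A j) x))"

text \<open>The images of the members form an arc cover of the middle space with the same lengths.
  The difficulty is that the quotient may identify points of two members that do not touch
  there.\<close>

lemma monotone_cover_TTV:
  assumes XX: "compact_Hausdorff_function X f" and c: "monotone_cover X f J A"
  shows "piecewise_monotone X f" "TTV X f = (\<Sum>j\<in>J. image_length f (A j))"
proof -
  interpret X: compact_Hausdorff_function X f by fact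
  define M where "M = middle_space X f"
  define l where "l = light_part f"
  define \<mu> where "\<mu> = monotone_part X f"
  interpret M: compact_Hausdorff_function M l
    unfolding M_def l_def by (rule compact_Hausdorff_function_middle_space) fact
  have fin: "finite J" and un: "(\<Union>j\<in>J. A j) = topspace X"
    and arc: "\<forall>j\<in>J. closedin X (A j) \<and> connectedin X (A j) \<and> A j \<noteq> {} \<and>
        (\<forall>y. connectedin X {x \<in> A j. f x = y})"
    and ext: "\<forall>j\<in>J. \<forall>k\<in>J. j \<noteq> k \<longrightarrow> (\<forall>x\<in>A j \<inter> A k. extremal f (A j) x)"
    using c unfolding monotone_cover_def by simp_all
  have sub: "A j \<subseteq> topspace X" if "j \<in> J" for j using that un by blast
  have l\<mu>: "l (\<mu> x) = f x" if "x \<in> topspace X" for x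
    using light_part_monotone_part[OF that] by (simp add: l_def \<mu>_def)
  have ext\<mu>: "extremal l (\<mu> ` A j) (\<mu> x) \<longleftrightarrow> extremal f (A j) x" if "j \<in> J" "x \<in> A j" for j x
    using that sub[OF that(1)] l\<mu> unfolding extremal_def by (simp add: subset_iff)
  have img: "l ` \<mu> ` A j = f ` A j" if "j \<in> J" for j
    using sub[OF that] l\<mu> by (force simp: image_image)
  have len: "image_length l (\<mu> ` A j) = image_length f (A j)" if "j \<in> J" for j
    unfolding image_length_def img[OF that] ..
  \<comment> \<open>The fibre component of \<open>x\<close> is connected and covered by the closed
    sets \<open>A j\<close> and \<open>Z\<close>, both of which it meets, so it contains a point of
    both. That point is extremal on \<open>A j\<close> and has the same value as
    \<open>x\<close>.\<close>
  have key: "extremal f (A j) x"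
    if j: "j \<in> J" "k \<in> J" "j \<noteq> k" and x: "x \<in> A j" and y: "y \<in> A k" and eq: "\<mu> x = \<mu> y" for j k x y
  proof (rule ccontr)
    assume ne: "\<not> extremal f (A j) x"
    have xX: "x \<in> topspace X" and yX: "y \<in> topspace X" using x y j sub by blast+
    have y\<mu>: "y \<in> \<mu> x" using monotone_part_eq_iff[OF xX yX, of f] eq by (simp add: \<mu>_def)
    have x\<mu>: "x \<in> \<mu> x" using monotone_part_self[OF xX] by (simp add: \<mu>_def)
    define Z where "Z = (\<Union>i\<in>J - {j}. A i)"
    have cZ: "closedin X Z" unfolding Z_def using fin arc by (intro closedin_Union) auto
    have "A j \<inter> Z \<inter> \<mu> x = {}"
    proof (rule ccontr)
      assume "A j \<inter> Z \<inter> \<mu> x \<noteq> {}"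
      then obtain z i where z: "z \<in> A j" "i \<in> J" "i \<noteq> j" "z \<in> A i" "z \<in> \<mu> x"
        by (auto simp: Z_def)
      then have "f z = f x" using monotone_part_subset[of X f x] by (auto simp: \<mu>_def)
      moreover have "extremal f (A j) z" using ext[rule_format, of j i z] z j(1) by simp
      ultimately show False using ne unfolding extremal_def by simp
    qed
    moreover have "\<mu> x \<subseteq> A j \<union> Z"
      using un monotone_part_subset[of X f x] by (auto simp: \<mu>_def Z_def)
    moreover have "Z \<inter> \<mu> x \<noteq> {}" "A j \<inter> \<mu> x \<noteq> {}" using x y y\<mu> x\<mu> j by (auto simp: Z_def)
    moreover have "closedin X (A j)" using arc j(1) by blast
    moreover have "connectedin X (\<mu> x)" by (simp add: \<mu>_def connectedin_monotone_part)
    ultimately show False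
      using cZ unfolding connectedin_closedin by blast
  qed
  have "arc_cover M l ((\<lambda>j. \<mu> ` A j) ` J)"
    unfolding arc_cover_def
  proof (intro conjI ballI impI)
    show "finite ((\<lambda>j. \<mu> ` A j) ` J)" using fin by simp
    show "\<Union>((\<lambda>j. \<mu> ` A j) ` J) = topspace M"
      unfolding M_def topspace_middle_space un[symmetric] \<mu>_def by blast
    fix B assume "B \<in> (\<lambda>j. \<mu> ` A j) ` J"
    then obtain j where j: "j \<in> J" "B = \<mu> ` A j" by blast
    show "closedin M B"
      using j(1) arc closed_map_monotone_part[OF X.compact X.Hausdorff X.cont]
      unfolding closed_map_def M_def \<mu>_def j(2) by blast
    show "connectedin M B"
      using j(1) arc connectedin_continuous_map_image[OF continuous_map_monotone_part, of X]
      unfolding M_def \<mu>_def j(2) by blast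
    show "B \<noteq> {}" using j arc by blast
    show "inj_on l B"
    proof (rule inj_onI)
      fix p q assume "p \<in> B" "q \<in> B" "l p = l q"
      then obtain x y where xy: "x \<in> A j" "y \<in> A j" "p = \<mu> x" "q = \<mu> y" using j by blast
      then have "f x = f y" using sub[OF j(1)] l\<mu> \<open>l p = l q\<close> by (metis subsetD)
      moreover have "connectedin X {z \<in> A j. f z = f x}" using arc j by blast
      ultimately show "p = q"
        using monotone_part_maximal[of X "{z \<in> A j. f z = f x}" x y f] xy
        by (auto simp: \<mu>_def constant_on_def)
    qed
    fix B' p assume B': "B' \<in> (\<lambda>j. \<mu> ` A j) ` J" "B \<noteq> B'" "p \<in> B \<inter> B'"
    then obtain k where k: "k \<in> J" "B' = \<mu> ` A k" by blast
    have "p \<in> \<mu> ` A j" "p \<in> \<mu> ` A k" using B'(3) j k by simp_all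
    then obtain x y where xy: "x \<in> A j" "y \<in> A k" "p = \<mu> x" "p = \<mu> y" by blast
    moreover have "j \<noteq> k" using B'(2) j k by blast
    ultimately have "extremal f (A j) x" using key[of j k x y] j k by simp
    then show "extremal l B p" using ext\<mu>[OF j(1) xy(1)] j xy by simp
  qed
  note E = M.arc_cover_edges[OF this]
  show "piecewise_monotone X f"
    unfolding piecewise_monotone_def Let_def M_def[symmetric] l_def[symmetric]
    using X.cont E(1,2,3) by (intro conjI ballI)
  have "TTV X f = sum (image_length l) ((\<lambda>j. \<mu> ` A j) ` J)"
    using E(4) by (simp add: TTV_def image_length_def M_def l_def)
  also have "\<dots> = (\<Sum>j\<in>J. image_length l (\<mu> ` A j))"
  \<comment> \<open>Members with equal images consist of extremal points only and have length 0, so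
    counting the image once loses nothing.\<close>
  proof (rule sum.reindex_nontrivial[OF fin, unfolded comp_def])
    fix j k assume jk: "j \<in> J" "k \<in> J" "j \<noteq> k" "\<mu> ` A j = \<mu> ` A k"
    have "extremal f (A j) x" if x: "x \<in> A j" for x
    proof -
      have "\<mu> x \<in> \<mu> ` A k" using jk(4) x by blast
      then obtain y where y: "y \<in> A k" "\<mu> x = \<mu> y" by blast
      show ?thesis by (rule key[OF jk(1-3) x y])
    qed
    then show "image_length l (\<mu> ` A j) = 0"
      using X.image_length_all_extremal[of "A j"] arc jk(1) len by simp
  qed
  finally show "TTV X f = (\<Sum>j\<in>J. image_length f (A j))" using len by simp
qed

section \<open>Cells\<close>

text \<open>\<open>F\<close> holds the levels that only one-point cells may hit. Cells are disjoint,
  while injectivity and extremality concern their closures, which are the pieces used in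
  covers.\<close>

definition cell_decomposition :: "'a topology \<Rightarrow> ('a \<Rightarrow> real) \<Rightarrow> real set \<Rightarrow> 'a set set \<Rightarrow> bool" where
  "cell_decomposition M l F \<Q> \<longleftrightarrow> finite \<Q> \<and> \<Union>\<Q> = topspace M \<and> pairwise disjnt \<Q> \<and>
     (\<forall>Q\<in>\<Q>. Q \<noteq> {} \<and> connectedin M Q \<and> inj_on l (M closure_of Q) \<and>
        ((\<exists>p. Q = {p}) \<or> openin M Q \<and> l ` Q \<inter> F = {})) \<and>
     (\<forall>Q\<in>\<Q>. \<forall>R\<in>\<Q>. Q \<noteq> R \<longrightarrow>
        (\<forall>p\<in>M closure_of Q \<inter> M closure_of R. extremal l (M closure_of Q) p))"

text \<open>Cut at the levels in \<open>F\<close> and at the end levels of all arcs. These finitely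
  many levels have finite fibres, which give the one-point cells; the rest of each arc splits over
  the gaps between the levels.\<close>

lemma (in compact_Hausdorff_function) cell_decomposition_exists:
  assumes c: "arc_cover M l \<A>" and F: "finite F"
  obtains \<Q> where "cell_decomposition M l F \<Q>"
proof -
  note cD = coverD[OF c]
  define G where "G = F \<union> (\<Union>A\<in>\<A>. l ` {p \<in> A. extremal l A p})"
  have G: "finite G" using F cD(1) finite_extremal[OF cD(6)] by (auto simp: G_def)
  have extG: "l p \<in> G" if "A \<in> \<A>" "p \<in> A" "extremal l A p" for A p
    using that by (auto simp: G_def)
  \<comment> \<open>The gap of \<open>G\<close> lying above exactly the levels in \<open>T\<close>.
    It is empty when \<open>T\<close> is not an initial segment of \<open>G\<close>; the resulting
    empty cells are discarded in \<open>open_cells\<close>.\<close>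
  define J where "J T = (\<Inter>v\<in>T. {v<..}) \<inter> (\<Inter>v\<in>G - T. {..<v})" for T
  have J_open: "open (J T)" if "T \<subseteq> G" for T
    unfolding J_def using G that finite_subset by (intro open_Int open_INT ballI) auto
  have J_interval: "is_interval (J T)" for T
    unfolding J_def is_interval_1 by (auto intro: less_le_trans le_less_trans)
  have J_G: "v \<notin> J T" if "v \<in> G" for v T
    using that unfolding J_def by (cases "v \<in> T") auto
  have J_dis: "T = T'" if "T \<subseteq> G" "T' \<subseteq> G" "t \<in> J T" "t \<in> J T'" for T T' t
  proof (rule ccontr)
    assume "T \<noteq> T'"
    then obtain v where "v \<in> T - T' \<or> v \<in> T' - T" by blast
    moreover have J_iff: "t \<in> J T \<longleftrightarrow> (\<forall>v\<in>T. v < t) \<and> (\<forall>v\<in>G - T. t < v)" for T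
      by (auto simp: J_def)
    ultimately have "v < t \<and> t < v" using that unfolding J_iff by blast
    then show False using less_asym by blast
  qed
  have J_cover: "t \<in> J {v \<in> G. v < t}" if "t \<notin> G" for t
    using that unfolding J_def by (auto simp: not_less le_less)
  define cell where "cell A T = {p \<in> A. l p \<in> J T}" for A T
  define V where "V = {p \<in> topspace M. l p \<in> G}"
  have V: "finite V"
  proof -
    have "V = (\<Union>y\<in>G. {p \<in> topspace M. l p = y})" by (auto simp: V_def)
    then show ?thesis using G finite_fibre[OF c] by simp
  qed
  define open_cells where "open_cells = (\<lambda>(A, T). cell A T) ` (\<A> \<times> Pow G) - {{}}"
  define \<Q> where "\<Q> = (\<lambda>p. {p}) ` V \<union> open_cells"
  have open_cellsE: "\<exists>A T. A \<in> \<A> \<and> T \<subseteq> G \<and> Q = cell A T \<and> Q \<noteq> {}" if "Q \<in> open_cells" for Q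
    using that by (auto simp: open_cells_def)
  have cell_sub: "cell A T \<subseteq> topspace M" if "A \<in> \<A>" for A T
    using that cD(2) by (auto simp: cell_def)
  have cell_open: "openin M (cell A T)" if A: "A \<in> \<A>" and T: "T \<subseteq> G" for A T
  proof -
    have "openin M {p \<in> topspace M. l p \<in> J T}"
      using J_open[OF T] by (intro openin_continuous_map_preimage[OF cont]) simp
    moreover have "closedin M (\<Union>(\<A> - {A}))" using cD(1,3) by (intro closedin_Union) auto
    \<comment> \<open>Over a gap no point of \<open>A\<close> is extremal, so no other arc passes
      through it; the cell is thus an open set minus a closed one.\<close>
    moreover have "cell A T = {p \<in> topspace M. l p \<in> J T} - \<Union>(\<A> - {A})"
    proof (intro equalityI subsetI)
      fix p assume p: "p \<in> cell A T"
      have "p \<notin> B" if "B \<in> \<A> - {A}" for B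
        using cD(7)[of A B p] extG[OF A, of p] J_G[of "l p" T] p A that by (auto simp: cell_def)
      then show "p \<in> {p \<in> topspace M. l p \<in> J T} - \<Union>(\<A> - {A})"
        using p cell_sub[OF A, of T] by (auto simp: cell_def)
    next
      fix p assume p: "p \<in> {p \<in> topspace M. l p \<in> J T} - \<Union>(\<A> - {A})"
      then have "p \<in> \<Union>\<A>" using cD(2) by simp
      then show "p \<in> cell A T" using p by (auto simp: cell_def)
    qed
    ultimately show ?thesis by (simp add: openin_diff)
  qed
  have cell_closure: "M closure_of cell A T \<subseteq> A" if "A \<in> \<A>" for A T
    by (rule closure_of_minimal) (use cD(3) that in \<open>auto simp: cell_def\<close>)
  have cell_unique: "A = B \<and> T = T'"
    if "A \<in> \<A>" "B \<in> \<A>" "T \<subseteq> G" "T' \<subseteq> G" "p \<in> cell A T" "p \<in> cell B T'" for A B T T' p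
  proof -
    have "A = B"
      using cD(7)[of A B p] extG[of A p] J_G[of "l p" T] that by (auto simp: cell_def)
    moreover have "T = T'" using J_dis[of T T' "l p"] that by (auto simp: cell_def)
    ultimately show ?thesis ..
  qed
  have dis: "Q \<inter> R = {}" if QR: "Q \<in> \<Q>" "R \<in> \<Q>" "Q \<noteq> R" for Q R
  proof (rule ccontr)
    assume "Q \<inter> R \<noteq> {}"
    then obtain p where p: "p \<in> Q" "p \<in> R" by blast
    have V_cell: "p \<notin> V" if S: "S \<in> open_cells" "p \<in> S" for S
      using open_cellsE[OF S(1)] S(2) J_G by (auto simp: V_def cell_def)
    show False
    proof (cases "p \<in> V")
      case True
      then have "Q = {p}" "R = {p}" using V_cell p QR by (auto simp: \<Q>_def)
      then show ?thesis using QR by simp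
    next
      case False
      then have "Q \<in> open_cells" "R \<in> open_cells" using p QR by (auto simp: \<Q>_def)
      then obtain A T B T' where "A \<in> \<A>" "T \<subseteq> G" "Q = cell A T" "B \<in> \<A>" "T' \<subseteq> G" "R = cell B T'"
        using open_cellsE by metis
      then show ?thesis using cell_unique[of A B T T' p] p QR(3) by simp
    qed
  qed
  have cl_sing: "M closure_of {p} = {p}" if "p \<in> V" for p
    using that closedin_Hausdorff_singleton[OF Hausdorff, of p] closure_of_closedin
    by (auto simp: V_def)
  have "cell_decomposition M l F \<Q>"
    unfolding cell_decomposition_def
  proof (intro conjI ballI impI)
    show "finite \<Q>" using V G cD(1) by (simp add: \<Q>_def open_cells_def)
    show "pairwise disjnt \<Q>" using dis by (simp add: pairwise_def disjnt_def)
    show "\<Union>\<Q> = topspace M"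
    proof (intro equalityI subsetI)
      fix p assume "p \<in> \<Union>\<Q>"
      then obtain Q where Q: "Q \<in> \<Q>" "p \<in> Q" by blast
      show "p \<in> topspace M"
      proof (cases "Q \<in> open_cells")
        case True
        then obtain A T where "A \<in> \<A>" "Q = cell A T" using open_cellsE by metis
        then show ?thesis using cell_sub Q(2) by blast
      next
        case False
        then show ?thesis using Q by (auto simp: \<Q>_def V_def)
      qed
    next
      fix p assume p: "p \<in> topspace M"
      show "p \<in> \<Union>\<Q>"
      proof (cases "p \<in> V")
        case False
        obtain A where A: "A \<in> \<A>" "p \<in> A" using p cD(2) by blast
        let ?T = "{v \<in> G. v < l p}"
        have pc: "p \<in> cell A ?T" using A J_cover[of "l p"] False p by (simp add: cell_def V_def)
        then have "cell A ?T \<in> open_cells"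
          unfolding open_cells_def using A by (intro DiffI image_eqI[of _ _ "(A, ?T)"]) auto
        then show ?thesis using pc by (auto simp: \<Q>_def)
      qed (auto simp: \<Q>_def)
    qed
    fix Q assume Q: "Q \<in> \<Q>"
    have cases: "(\<exists>p\<in>V. Q = {p}) \<or> (\<exists>A T. A \<in> \<A> \<and> T \<subseteq> G \<and> Q = cell A T \<and> Q \<noteq> {})"
      using Q open_cellsE by (auto simp: \<Q>_def)
    show "Q \<noteq> {}" using cases by blast
    show "connectedin M Q"
      using cases
    proof (elim disjE exE bexE conjE)
      fix p assume "p \<in> V" "Q = {p}"
      then show ?thesis by (simp add: V_def)
    next
      fix A T assume "A \<in> \<A>" "Q = cell A T"
      then show ?thesis
        unfolding cell_def using connectedin_arc_preimage[OF cD(4,6) J_interval] by simp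
    qed
    show "inj_on l (M closure_of Q)"
      using cases
    proof (elim disjE exE bexE conjE)
      fix p assume "p \<in> V" "Q = {p}"
      then show ?thesis by (simp add: cl_sing)
    next
      fix A T assume "A \<in> \<A>" "Q = cell A T"
      then show ?thesis using inj_on_subset[OF cD(6) cell_closure] by simp
    qed
    show "(\<exists>p. Q = {p}) \<or> openin M Q \<and> l ` Q \<inter> F = {}"
      using cases
    proof (elim disjE exE bexE conjE)
      fix A T assume "A \<in> \<A>" "T \<subseteq> G" "Q = cell A T"
      then show ?thesis using cell_open J_G by (auto simp: cell_def G_def)
    qed blast
    fix R p assume R: "R \<in> \<Q>" "Q \<noteq> R" and p: "p \<in> M closure_of Q \<inter> M closure_of R"
    show "extremal l (M closure_of Q) p"
      using cases
    proof (elim disjE exE bexE conjE)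
      fix q assume "q \<in> V" "Q = {q}"
      then show ?thesis using p by (simp add: cl_sing extremal_def)
    next
      fix A T assume A: "A \<in> \<A>" "T \<subseteq> G" "Q = cell A T"
      \<comment> \<open>\<open>Q\<close> is open and disjoint from \<open>R\<close>, so
        \<open>p\<close> lies off \<open>Q\<close> and its level is at or beyond an end of the gap.
        The level of that end bounds \<open>l\<close> on the whole closure of
        \<open>Q\<close>.\<close>
      have "p \<notin> Q"
        using openin_Int_closure_of_eq_empty[OF cell_open[OF A(1,2)], of R] dis[OF Q R(1,2)] p A(3)
        by blast
      moreover have "p \<in> A" using p cell_closure[OF A(1)] A(3) by blast
      ultimately have "l p \<notin> J T" using A(3) by (simp add: cell_def)
      then consider v where "v \<in> T" "l p \<le> v" | v where "v \<in> G - T" "v \<le> l p"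
        unfolding J_def by (auto simp: not_less)
      then show ?thesis
      proof cases
        case 1
        have "M closure_of Q \<subseteq> {x \<in> topspace M. l x \<in> {v..}}"
        proof (rule closure_of_minimal)
          show "closedin M {x \<in> topspace M. l x \<in> {v..}}"
            by (intro closedin_continuous_map_preimage[OF cont]) simp
          show "Q \<subseteq> {x \<in> topspace M. l x \<in> {v..}}"
            using 1(1) A cell_sub[OF A(1), of T] by (auto simp: cell_def J_def intro: less_imp_le)
        qed
        then show ?thesis using 1(2) unfolding extremal_def by (auto intro: order_trans)
      next
        case 2
        have "M closure_of Q \<subseteq> {x \<in> topspace M. l x \<in> {..v}}"
        proof (rule closure_of_minimal)
          show "closedin M {x \<in> topspace M. l x \<in> {..v}}"
            by (intro closedin_continuous_map_preimage[OF cont]) simp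
          show "Q \<subseteq> {x \<in> topspace M. l x \<in> {..v}}"
            using 2(1) A cell_sub[OF A(1), of T] by (auto simp: cell_def J_def intro: less_imp_le)
        qed
        then show ?thesis using 2(2) unfolding extremal_def by (auto intro: order_trans)
      qed
    qed
  qed
  then show ?thesis using that by blast
qed

section \<open>Varilet supports and amplitudes\<close>

lemma (in compact_Hausdorff_function) image_length_nonneg:
  assumes "closedin M A" "A \<noteq> {}" shows "0 \<le> image_length l A"
proof -
  obtain a b where ab: "a \<in> A" "b \<in> A" "\<And>q. q \<in> A \<Longrightarrow> l a \<le> l q \<and> l q \<le> l b"
    using attains_range[OF assms] by blast
  then have "image_length l A = l b - l a" by (rule image_length_eq)
  then show ?thesis using ab by simp
qed

lemma (in compact_Hausdorff_function) image_length_zero: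
  assumes "closedin M A" "image_length l A = 0" "inj_on l A" "p \<in> A" "q \<in> A" shows "p = q"
proof -
  obtain a b where ab: "a \<in> A" "b \<in> A" "\<And>q. q \<in> A \<Longrightarrow> l a \<le> l q \<and> l q \<le> l b"
    using attains_range[OF assms(1)] assms(4) by blast
  then have "image_length l A = l b - l a" by (rule image_length_eq)
  then have "l p = l q" using assms(2) ab(3)[OF assms(4)] ab(3)[OF assms(5)] by linarith
  then show ?thesis using assms by (meson inj_onD)
qed

lemma constant_on_closure_of:
  assumes g: "continuous_map X euclideanreal g" and "S \<subseteq> topspace X" "g constant_on S"
  shows "g constant_on (X closure_of S)"
proof -
  obtain y where y: "\<And>x. x \<in> S \<Longrightarrow> g x = y" using assms(3) by (auto simp: constant_on_def)
  have "X closure_of S \<subseteq> {x \<in> topspace X. g x \<in> {y}}"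
  proof (rule closure_of_minimal)
    show "closedin X {x \<in> topspace X. g x \<in> {y}}"
      by (intro closedin_continuous_map_preimage[OF g]) simp
    show "S \<subseteq> {x \<in> topspace X. g x \<in> {y}}" using assms(2) y by auto
  qed
  then show ?thesis unfolding constant_on_def by blast
qed

text \<open>A finite connected set of reals has at most one element. This passes from constancy on
  finitely many cells to constancy on a component.\<close>

lemma finite_image_constant_on:
  assumes g: "continuous_map (subtopology X K) euclideanreal g" and K: "connectedin X K"
    and fin: "finite (g ` K)"
  shows "g constant_on K"
proof -
  have "connectedin (subtopology X K) K" using K by (simp add: connectedin_subtopology)
  then have "connected (g ` K)" using connectedin_continuous_map_image[OF g] by fastforce
  then have "g ` K = {} \<or> (\<exists>y. g ` K = {y})" using fin connected_finite_iff_sing by blast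
  then show ?thesis unfolding constant_on_def by blast
qed

text \<open>Regions are overwritten one at a time. On the frontier of the next one, earlier changes,
  made on regions disjoint from it, have left \<open>l\<close> unchanged, so the constant
  \<open>c k\<close> fits continuously.\<close>

lemma (in compact_Hausdorff_function) collapse_regions:
  assumes "finite T" "\<And>k. k \<in> T \<Longrightarrow> closedin M (C k)"
    "\<And>k p. k \<in> T \<Longrightarrow> p \<in> M frontier_of C k \<Longrightarrow> l p = c k"
    "pairwise (\<lambda>j k. C j \<inter> C k = {}) T"
  shows "\<exists>u. continuous_map M euclideanreal u \<and> (\<forall>k\<in>T. \<forall>p\<in>C k. u p = c k) \<and>
           (\<forall>p. p \<notin> (\<Union>k\<in>T. C k) \<longrightarrow> u p = l p)"
  using assms
proof (induction T rule: finite_induct)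
  case empty
  then show ?case using cont by (intro exI[of _ l]) simp
next
  case (insert k T)
  have "\<exists>u. continuous_map M euclideanreal u \<and> (\<forall>k\<in>T. \<forall>p\<in>C k. u p = c k) \<and>
           (\<forall>p. p \<notin> (\<Union>k\<in>T. C k) \<longrightarrow> u p = l p)"
  proof (rule insert.IH)
    show "pairwise (\<lambda>j k. C j \<inter> C k = {}) T" using insert.prems(3) by (simp add: pairwise_insert)
  qed (use insert.prems in auto)
  then obtain u where u: "continuous_map M euclideanreal u" "\<forall>k\<in>T. \<forall>p\<in>C k. u p = c k"
    "\<forall>p. p \<notin> (\<Union>k\<in>T. C k) \<longrightarrow> u p = l p"
    by (elim exE conjE)
  have dis: "p \<notin> (\<Union>j\<in>T. C j)" if "p \<in> C k" for p
  proof -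
    have "C k \<inter> C j = {}" if "j \<in> T" for j
      using insert.prems(3) insert.hyps(2) that unfolding pairwise_insert by metis
    then show ?thesis using \<open>p \<in> C k\<close> by blast
  qed
  let ?v = "\<lambda>p. if p \<in> C k then c k else u p"
  have "continuous_map M euclideanreal ?v"
  proof (rule continuous_map_cases)
    show "continuous_map (subtopology M (M closure_of {x. x \<notin> C k})) euclideanreal u"
      using u(1) by (rule continuous_map_from_subtopology)
    fix p assume "p \<in> M frontier_of {x. x \<in> C k}"
    then have p: "p \<in> M frontier_of C k" by simp
    then have "p \<in> C k" using insert.prems(1)[of k] frontier_of_subset_closedin by blast
    then have "u p = l p" using u(3) dis by blast
    then show "c k = u p" using insert.prems(2)[of k p] p by simp
  qed simp
  moreover have "\<forall>j\<in>insert k T. \<forall>p\<in>C j. ?v p = c j" using u(2) dis by auto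
  moreover have "\<forall>p. p \<notin> (\<Union>k\<in>insert k T. C k) \<longrightarrow> ?v p = l p" using u(3) by auto
  ultimately show ?case by (intro exI[of _ ?v] conjI)
qed

text \<open>Within a member a level set is empty, a point, or the whole member.\<close>

lemma monotone_cover_arcs:
  assumes "finite J" "(\<Union>j\<in>J. A j) = topspace X"
    "\<And>j. j \<in> J \<Longrightarrow> closedin X (A j)" "\<And>j. j \<in> J \<Longrightarrow> connectedin X (A j)" "\<And>j. j \<in> J \<Longrightarrow> A j \<noteq> {}"
    and fib: "\<And>j. j \<in> J \<Longrightarrow> inj_on f (A j) \<or> f constant_on (A j)"
    and ext: "\<And>j k x. \<lbrakk>j \<in> J; k \<in> J; j \<noteq> k; x \<in> A j; x \<in> A k\<rbrakk> \<Longrightarrow> extremal f (A j) x"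
  shows "monotone_cover X f J A"
proof -
  have "connectedin X {x \<in> A j. f x = y}" if j: "j \<in> J" for j y
  proof (cases "\<exists>x\<in>A j. f x = y")
    case True
    then obtain x where x: "x \<in> A j" "f x = y" by blast
    have "{x \<in> A j. f x = y} = {x} \<or> {x \<in> A j. f x = y} = A j"
      using fib[OF j] x by (auto simp: inj_on_def constant_on_def)
    moreover have "x \<in> topspace X" using x j assms(2) by blast
    ultimately show ?thesis using assms(4)[OF j] by auto
  next
    case False
    then have "{x \<in> A j. f x = y} = {}" by blast
    then show ?thesis by (metis connectedin_empty)
  qed
  then show ?thesis
    unfolding monotone_cover_def using assms(1-5) ext by simp
qed

text \<open>The levels reserved for one-point cells are the boundary values of the regions.
  \<open>no_isolated\<close> is the form in which nonconstancy of \<open>f\<close> is used.\<close>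

locale varilet_cells = compact_Hausdorff_function M l for M :: "'a topology" and l +
  fixes I :: "real set" and C :: "real \<Rightarrow> 'a set" and \<Q> :: "'a set set"
  assumes lens: "varilet_lens M l I C"
    and cells: "cell_decomposition M l (\<Union>i\<in>I. l ` (M frontier_of C i)) \<Q>"
    and no_isolated: "\<not> openin M {p}"
begin

lemma finite_I: "finite I" and C_Union: "(\<Union>i\<in>I. C i) = topspace M"
  using lens unfolding varilet_lens_def by auto

lemma C_closed: "i \<in> I \<Longrightarrow> closedin M (C i)"
  and C_connected: "i \<in> I \<Longrightarrow> connectedin M (C i)"
  and C_interior: "i \<in> I \<Longrightarrow> M interior_of C i \<noteq> {}"
  and C_frontier: "i \<in> I \<Longrightarrow> l constant_on (M frontier_of C i)"
  using lens unfolding varilet_lens_def constant_boundary_region_def by auto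

lemma C_subset: "i \<in> I \<Longrightarrow> C i \<subseteq> topspace M"
  by (simp add: C_closed closedin_subset)

lemma C_nonempty: "i \<in> I \<Longrightarrow> C i \<noteq> {}"
  using C_interior[of i] interior_of_subset[of M "C i"] by blast

lemma C_nested: "i \<in> I \<Longrightarrow> j \<in> I \<Longrightarrow> i < j \<Longrightarrow> p \<in> C i \<Longrightarrow> p \<in> C j \<Longrightarrow> C j \<subset> C i"
proof -
  assume ij: "i \<in> I" "j \<in> I" "i < j" and p: "p \<in> C i" "p \<in> C j"
  have "nested I C" using lens unfolding varilet_lens_def by simp
  then have "C j \<subset> C i \<or> C i \<inter> C j = {}" unfolding nested_def using ij by simp
  then show ?thesis using p by blast
qed

lemma boundary_value: "i \<in> I \<Longrightarrow> p \<in> M frontier_of C i \<Longrightarrow> l p = boundary_value M l (C i)"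
proof -
  assume i: "i \<in> I" and p: "p \<in> M frontier_of C i"
  then have "l ` (M frontier_of C i) = {l p}"
    using C_frontier[OF i] unfolding constant_on_def by fastforce
  then show ?thesis by (simp add: boundary_value_def)
qed

lemma finite_\<Q>: "finite \<Q>" and \<Q>_Union: "\<Union>\<Q> = topspace M"
  using cells unfolding cell_decomposition_def by simp_all

lemma \<Q>_nonempty: "Q \<in> \<Q> \<Longrightarrow> Q \<noteq> {}"
  and \<Q>_connected: "Q \<in> \<Q> \<Longrightarrow> connectedin M Q"
  and \<Q>_inj: "Q \<in> \<Q> \<Longrightarrow> inj_on l (M closure_of Q)"
  and \<Q>_cases: "Q \<in> \<Q> \<Longrightarrow> (\<exists>p. Q = {p}) \<or> openin M Q \<and> l ` Q \<inter> (\<Union>i\<in>I. l ` (M frontier_of C i)) = {}"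
  using cells unfolding cell_decomposition_def by simp_all

lemma \<Q>_extremal:
  assumes "Q \<in> \<Q>" "R \<in> \<Q>" "Q \<noteq> R" "p \<in> M closure_of Q" "p \<in> M closure_of R"
  shows "extremal l (M closure_of Q) p"
proof -
  have "\<forall>Q\<in>\<Q>. \<forall>R\<in>\<Q>. Q \<noteq> R \<longrightarrow>
        (\<forall>p\<in>M closure_of Q \<inter> M closure_of R. extremal l (M closure_of Q) p)"
    using cells unfolding cell_decomposition_def by simp
  then show ?thesis using assms by simp
qed

lemma \<Q>_subset: "Q \<in> \<Q> \<Longrightarrow> Q \<subseteq> topspace M"
  using \<Q>_Union by blast

lemma \<Q>_closure: "Q \<in> \<Q> \<Longrightarrow> Q \<subseteq> M closure_of Q"
  by (simp add: \<Q>_subset closure_of_subset)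

text \<open>A connected set that misses the frontier of \<open>C i\<close> lies inside or outside
  \<open>C i\<close>; avoiding the boundary values guarantees this for open cells.\<close>

lemma \<Q>_C: "Q \<in> \<Q> \<Longrightarrow> i \<in> I \<Longrightarrow> Q \<subseteq> C i \<or> Q \<inter> C i = {}"
proof -
  assume Q: "Q \<in> \<Q>" and i: "i \<in> I"
  from \<Q>_cases[OF Q] show ?thesis
  proof (elim disjE exE conjE)
    assume "l ` Q \<inter> (\<Union>i\<in>I. l ` (M frontier_of C i)) = {}"
    then have "Q \<inter> M frontier_of C i = {}" using i by blast
    then show ?thesis using connectedin_Int_frontier_of[OF \<Q>_connected[OF Q], of "C i"] by blast
  qed blast
qed

text \<open>The support before taking the closure. The sets \<open>S i\<close> partition the space,
  while the supports \<open>D i\<close> may share boundary points.\<close>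

definition S :: "real \<Rightarrow> 'a set" where
  "S i = C i - (\<Union>j\<in>{j \<in> I. i < j}. C j)"

abbreviation D :: "real \<Rightarrow> 'a set" where "D \<equiv> varilet_support M I C"

lemma D_def: "D i = M closure_of S i"
  by (simp add: varilet_support_def S_def)

definition index :: "'a set \<Rightarrow> real" where
  "index Q = Max {i \<in> I. Q \<subseteq> C i}"

lemma index: assumes "Q \<in> \<Q>" shows "index Q \<in> I" "Q \<subseteq> S (index Q)"
proof -
  let ?A = "{i \<in> I. Q \<subseteq> C i}"
  obtain p where p: "p \<in> Q" using \<Q>_nonempty[OF assms] by blast
  then obtain i where "i \<in> I" "p \<in> C i" using C_Union \<Q>_subset[OF assms] by blast
  then have "?A \<noteq> {}" using \<Q>_C[OF assms, of i] p by blast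
  moreover have fin: "finite ?A" using finite_I by simp
  ultimately have "index Q \<in> ?A" unfolding index_def by (intro Max_in)
  then show "index Q \<in> I" and sub: "Q \<subseteq> S (index Q)"
  proof (simp_all)
    have "Q \<inter> C j = {}" if "j \<in> I" "index Q < j" for j
    proof (rule ccontr)
      assume "Q \<inter> C j \<noteq> {}"
      then have "j \<in> ?A" using \<Q>_C[OF assms that(1)] that(1) by blast
      then show False using Max_ge[OF fin, of j] that(2) unfolding index_def by simp
    qed
    then show "Q \<subseteq> S (index Q)" using \<open>index Q \<in> ?A\<close> by (auto simp: S_def)
  qed
qed

lemma S_disjoint: "i \<in> I \<Longrightarrow> j \<in> I \<Longrightarrow> i \<noteq> j \<Longrightarrow> S i \<inter> S j = {}"
  by (cases "i < j") (auto simp: S_def)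

lemma S_eq: assumes i: "i \<in> I" shows "S i = \<Union>{Q \<in> \<Q>. index Q = i}"
proof (intro equalityI subsetI)
  fix p assume p: "p \<in> S i"
  then have "p \<in> topspace M" using C_subset[OF i] by (auto simp: S_def)
  then obtain Q where Q: "Q \<in> \<Q>" "p \<in> Q" using \<Q>_Union by blast
  then have "index Q = i" using S_disjoint[OF i index(1)[OF Q(1)]] index(2)[OF Q(1)] p by blast
  then show "p \<in> \<Union>{Q \<in> \<Q>. index Q = i}" using Q by blast
qed (use index in blast)

lemma S_subset: "i \<in> I \<Longrightarrow> S i \<subseteq> topspace M"
  using C_subset by (auto simp: S_def)

lemma S_subset_D: "i \<in> I \<Longrightarrow> S i \<subseteq> D i"
  by (simp add: D_def closure_of_subset S_subset)

lemma D_subset: "i \<in> I \<Longrightarrow> D i \<subseteq> C i"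
  unfolding D_def by (rule closure_of_minimal) (auto simp: S_def C_closed)

lemma D_eq: assumes i: "i \<in> I" shows "D i = (\<Union>Q\<in>{Q \<in> \<Q>. index Q = i}. M closure_of Q)"
  unfolding D_def S_eq[OF i] using closure_of_Union[of "{Q \<in> \<Q>. index Q = i}" M] finite_\<Q> by simp

text \<open>An open cell disjoint from \<open>S i\<close> misses its closure too. A one-point cell
  may lie in \<open>D i\<close> but not in \<open>S i\<close>; every function is constant on it
  anyway.\<close>

lemma \<Q>_D: assumes "Q \<in> \<Q>" "i \<in> I" shows "(\<exists>p. Q = {p}) \<or> Q \<subseteq> S i \<or> Q \<inter> D i = {}"
proof (cases "\<exists>p. Q = {p}")
  case False
  then have op: "openin M Q" using \<Q>_cases[OF assms(1)] by blast
  show ?thesis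
  proof (cases "index Q = i")
    case True
    then show ?thesis using index(2)[OF assms(1)] by blast
  next
    case False
    then have "Q \<inter> S i = {}"
      using S_disjoint[OF assms(2) index(1)[OF assms(1)]] index(2)[OF assms(1)] by blast
    then show ?thesis using openin_Int_closure_of_eq_empty[OF op, of "S i"] by (simp add: D_def)
  qed
qed blast

text \<open>By nesting, the region of least index contains every region that meets it. The remaining
  ones form a closed set disjoint from it, so connectedness of \<open>K\<close> rules them
  out.\<close>

lemma connected_union_of_regions:
  assumes K: "connectedin M K" and T: "T \<subseteq> I" "T \<noteq> {}" and eq: "K = (\<Union>j\<in>T. C j)"
  shows "C (Min T) = K"
proof -
  define m where "m = Min T"
  have fin: "finite T" using T finite_I finite_subset by blast
  then have m: "m \<in> T" and least: "\<And>j. j \<in> T \<Longrightarrow> m \<le> j" using T(2) by (auto simp: m_def)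
  define R where "R = (\<Union>j\<in>{j \<in> T. C j \<inter> C m = {}}. C j)"
  have R: "closedin M R" unfolding R_def using fin T C_closed by (intro closedin_Union) auto
  have "C j \<subseteq> C m \<union> R" if j: "j \<in> T" for j
  proof (cases "C j \<inter> C m = {}")
    case True
    then show ?thesis using j by (auto simp: R_def)
  next
    case False
    then obtain p where "p \<in> C j" "p \<in> C m" by blast
    then have "j = m \<or> C j \<subset> C m"
      using C_nested[of m j p] T(1) m j least[OF j] by (auto simp: le_less)
    then show ?thesis by blast
  qed
  then have sub: "K \<subseteq> C m \<union> R" using eq by blast
  have "C m \<inter> R \<inter> K = {}" by (auto simp: R_def)
  moreover have "C m \<inter> K \<noteq> {}" using C_nonempty[of m] m T(1) eq by blast
  moreover have "closedin M (C m)" using C_closed m T(1) by blast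
  ultimately have "R \<inter> K = {}" using K R sub unfolding connectedin_closedin by blast
  then show ?thesis using sub eq m unfolding m_def[symmetric] by blast
qed

text \<open>If deeper regions covered \<open>C i\<close>, connectedness would make one of them equal
  to \<open>C i\<close>, whereas nesting makes them proper subsets.\<close>

lemma S_nonempty: assumes i: "i \<in> I" shows "S i \<noteq> {}"
proof
  assume "S i = {}"
  then have sub: "C i \<subseteq> (\<Union>j\<in>{j \<in> I. i < j}. C j)" by (auto simp: S_def)
  define T where "T = {j \<in> I. i < j \<and> C j \<subset> C i}"
  have eq: "C i = (\<Union>j\<in>T. C j)"
  proof (intro equalityI subsetI)
    fix p assume p: "p \<in> C i"
    then obtain j where "j \<in> I" "i < j" "p \<in> C j" using sub by blast
    then show "p \<in> (\<Union>j\<in>T. C j)" using C_nested[OF i, of j p] p by (auto simp: T_def)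
  qed (auto simp: T_def)
  have ne: "T \<noteq> {}"
  proof
    assume "T = {}"
    then show False using eq C_nonempty[OF i] by simp
  qed
  have "C (Min T) = C i"
    by (rule connected_union_of_regions[OF C_connected[OF i] _ ne eq]) (auto simp: T_def)
  moreover have "Min T \<in> T" using ne finite_I by (intro Min_in) (auto simp: T_def)
  ultimately show False unfolding T_def by blast
qed

text \<open>\<open>S i\<close> is relatively open in the connected set \<open>C i\<close>, which has
  more than one point: a single point with nonempty interior would be isolated.\<close>

lemma infinite_S: assumes i: "i \<in> I" shows "infinite (S i)"
proof -
  obtain p where p: "p \<in> S i" using S_nonempty[OF i] by blast
  define U where "U = topspace M - (\<Union>j\<in>{j \<in> I. i < j}. C j)"
  have "closedin M (\<Union>j\<in>{j \<in> I. i < j}. C j)"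
    using finite_I C_closed by (intro closedin_Union) auto
  then have U: "openin M U" by (simp add: U_def openin_diff)
  have eq: "S i = C i \<inter> U" using C_subset[OF i] by (auto simp: S_def U_def)
  have "C i \<noteq> {p}"
  proof
    assume "C i = {p}"
    then have "M interior_of C i = {p}"
      using C_interior[OF i] interior_of_subset[of M "C i"] subset_singletonD by metis
    then show False using no_isolated openin_interior_of by metis
  qed
  then obtain q where "q \<in> C i" "p \<noteq> q" using p by (auto simp: S_def)
  then show ?thesis
    unfolding eq
    using connectedin_infinite_Int_openin[OF Hausdorff C_connected[OF i], of p q U] p U
    by (simp add: eq)
qed

text \<open>The total variation here refers to the middle space of the restriction to
  \<open>D i\<close>, whose edges may differ from those of \<open>M\<close>. The closed cells in
  \<open>D i\<close> form a monotone cover, which gives the value without describing that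
  space.\<close>

lemma amplitude_eq:
  assumes i: "i \<in> I"
  shows "amplitude M l I C i = (\<Sum>Q\<in>{Q \<in> \<Q>. index Q = i}. image_length l (M closure_of Q))"
  unfolding amplitude_def
proof (rule monotone_cover_TTV)
  let ?X = "subtopology M (D i)" and ?J = "{Q \<in> \<Q>. index Q = i}"
  have clD: "closedin M (D i)" by (simp add: D_def)
  show "compact_Hausdorff_function ?X l"
    using clD compact Hausdorff cont
    by (simp add: compact_Hausdorff_function_def closedin_compact_space compact_space_subtopology
        Hausdorff_space_subtopology continuous_map_from_subtopology)
  have sub: "M closure_of Q \<subseteq> D i" if "Q \<in> ?J" for Q using that D_eq[OF i] by blast
  have top: "topspace ?X = D i" using clD closedin_subset by fastforce
  show "monotone_cover ?X l ?J ((closure_of) M)"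
  proof (rule monotone_cover_arcs)
    show "finite ?J" using finite_\<Q> by simp
    show "(\<Union>Q\<in>?J. M closure_of Q) = topspace ?X" unfolding top using D_eq[OF i] by simp
    fix Q assume Q: "Q \<in> ?J"
    show "closedin ?X (M closure_of Q)"
      by (rule closedin_subset_topspace[OF closedin_closure_of sub[OF Q]])
    show "connectedin ?X (M closure_of Q)"
      using Q sub[OF Q] \<Q>_connected by (simp add: connectedin_subtopology connectedin_closure_of)
    show "M closure_of Q \<noteq> {}" using Q \<Q>_nonempty[of Q] \<Q>_closure[of Q] by blast
    show "inj_on l (M closure_of Q) \<or> l constant_on (M closure_of Q)" using Q \<Q>_inj by blast
    show "extremal l (M closure_of Q) p"
      if "R \<in> ?J" "Q \<noteq> R" "p \<in> M closure_of Q" "p \<in> M closure_of R" for R p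
      using \<Q>_extremal[of Q R p] Q that by simp
  qed
qed

text \<open>If all lengths vanished, injectivity would shrink every closed cell to a point and make
  \<open>S i\<close> finite.\<close>

lemma amplitude_pos: assumes i: "i \<in> I" shows "0 < amplitude M l I C i"
proof -
  let ?J = "{Q \<in> \<Q>. index Q = i}"
  have ne: "M closure_of Q \<noteq> {}" if "Q \<in> ?J" for Q
    using that \<Q>_nonempty[of Q] \<Q>_closure[of Q] by blast
  have nn: "0 \<le> image_length l (M closure_of Q)" if "Q \<in> ?J" for Q
    using image_length_nonneg[OF closedin_closure_of ne[OF that]] .
  have "\<exists>Q\<in>?J. image_length l (M closure_of Q) \<noteq> 0"
  proof (rule ccontr)
    assume zero: "\<not> ?thesis"
    have "finite Q" if Q: "Q \<in> ?J" for Q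
    proof -
      obtain p where p: "p \<in> M closure_of Q" using ne[OF Q] by blast
      have "image_length l (M closure_of Q) = 0" using zero Q by blast
      then have "q = p" if "q \<in> M closure_of Q" for q
        using image_length_zero[OF closedin_closure_of _ \<Q>_inj that p] Q by blast
      then have "Q \<subseteq> {p}" using \<Q>_closure[of Q] Q by blast
      then show ?thesis using finite_subset by blast
    qed
    then have "finite (S i)" unfolding S_eq[OF i] using finite_\<Q> by (intro finite_Union) auto
    then show False using infinite_S[OF i] by simp
  qed
  then have "(\<Sum>Q\<in>?J. image_length l (M closure_of Q)) \<noteq> 0"
    using nn finite_\<Q> by (subst sum_nonneg_eq_0_iff) auto
  moreover have "0 \<le> (\<Sum>Q\<in>?J. image_length l (M closure_of Q))" using nn by (rule sum_nonneg)
  ultimately show ?thesis unfolding amplitude_eq[OF i] by simp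
qed

end

section \<open>Varilets on the middle space\<close>

context varilet_cells
begin

lemma cell_component:
  assumes "K \<in> connected_components_of M" "Q \<in> \<Q>"
  shows "Q \<subseteq> K \<or> Q \<inter> K = {}"
  using connected_components_of_maximal[OF assms(1) \<Q>_connected[OF assms(2)]]
  by (auto simp: disjnt_iff)

text \<open>Each component contains a cell, and a cell determines its component. Finiteness makes
  components open, so that functions can be set to 0 off one of them continuously.\<close>

lemma finite_components: "finite (connected_components_of M)"
proof (rule finite_subset)
  show "connected_components_of M
      \<subseteq> (\<lambda>Q. connected_component_of_set M (SOME q. q \<in> Q)) ` \<Q>"
  proof
    fix K assume K: "K \<in> connected_components_of M"
    then obtain p where p: "p \<in> K" "p \<in> topspace M"
      using nonempty_connected_components_of connected_components_of_subset by blast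
    then obtain Q where Q: "Q \<in> \<Q>" "p \<in> Q" using \<Q>_Union by blast
    define q where "q = (SOME q. q \<in> Q)"
    have "q \<in> Q" unfolding q_def using Q(2) by (rule someI)
    then have q: "q \<in> K" "q \<in> topspace M"
      using cell_component[OF K Q(1)] p(1) Q \<Q>_subset by blast+
    have "connected_component_of_set M q \<in> connected_components_of M"
      using q by (simp add: connected_component_in_connected_components_of)
    moreover have "q \<in> connected_component_of_set M q" using q by (simp add: connected_component_of_refl)
    ultimately have "K = connected_component_of_set M q"
      using connected_components_of_overlap[OF K] q(1) by blast
    then show "K \<in> (\<lambda>Q. connected_component_of_set M (SOME q. q \<in> Q)) ` \<Q>"
      using Q(1) unfolding q_def by blast
  qed
qed (simp add: finite_\<Q>)

lemma openin_component: "K \<in> connected_components_of M \<Longrightarrow> openin M K"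
  using open_in_finite_connected_components finite_components by blast

lemma constant_on_component:
  assumes K: "K \<in> connected_components_of M"
    and d: "continuous_map (subtopology M K) euclideanreal d"
    and const: "\<And>Q. Q \<in> \<Q> \<Longrightarrow> Q \<subseteq> K \<Longrightarrow> d constant_on Q"
  shows "d constant_on K"
proof (rule finite_image_constant_on[OF d connectedin_connected_components_of[OF K]])
  have "finite (d ` Q)" if Q: "Q \<in> \<Q>" "Q \<subseteq> K" for Q
  proof -
    obtain y where "\<forall>x\<in>Q. d x = y" using const[OF Q] unfolding constant_on_def by blast
    then have "d ` Q \<subseteq> {y}" by blast
    then show ?thesis by (rule finite_subset) simp
  qed
  then have fin: "finite (\<Union>Q\<in>{Q \<in> \<Q>. Q \<subseteq> K}. d ` Q)" using finite_\<Q> by simp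
  have "d ` K \<subseteq> (\<Union>Q\<in>{Q \<in> \<Q>. Q \<subseteq> K}. d ` Q)"
  proof
    fix y assume "y \<in> d ` K"
    then obtain p where p: "p \<in> K" "y = d p" by blast
    then obtain Q where Q: "Q \<in> \<Q>" "p \<in> Q"
      using \<Q>_Union connected_components_of_subset[OF K] by blast
    then have "Q \<subseteq> K" using cell_component[OF K Q(1)] p(1) by blast
    then show "y \<in> (\<Union>Q\<in>{Q \<in> \<Q>. Q \<subseteq> K}. d ` Q)" using Q p(2) by blast
  qed
  then show "finite (d ` K)" using fin by (rule finite_subset)
qed

section \<open>Existence and uniqueness of the component extension\<close>

abbreviation Ms :: "real \<Rightarrow> 'a set" where
  "Ms i \<equiv> component_containing M (D i)"

lemma D_nonempty: "i \<in> I \<Longrightarrow> D i \<noteq> {}"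
  using S_nonempty[of i] S_subset_D[of i] by blast

lemma Ms: assumes i: "i \<in> I" shows "Ms i \<in> connected_components_of M" "C i \<subseteq> Ms i"
proof -
  obtain p where p: "p \<in> D i" using D_nonempty[OF i] by blast
  define K where "K = connected_component_of_set M p"
  have pC: "p \<in> C i" using p D_subset[OF i] by blast
  have K: "K \<in> connected_components_of M"
    unfolding K_def using pC C_subset[OF i]
    by (auto simp: connected_component_in_connected_components_of)
  have CK: "C i \<subseteq> K" unfolding K_def using connected_component_of_maximal[OF C_connected[OF i] pC] .
  have "Ms i = K"
    unfolding component_containing_def
  proof (rule the_equality)
    show "K \<in> connected_components_of M \<and> D i \<subseteq> K" using K CK D_subset[OF i] by blast
    fix K' assume "K' \<in> connected_components_of M \<and> D i \<subseteq> K'"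
    then show "K' = K" using connected_components_of_overlap[OF K, of K'] p CK pC by blast
  qed
  then show "Ms i \<in> connected_components_of M" "C i \<subseteq> Ms i" using K CK by simp_all
qed

text \<open>At a point of the smaller region on the frontier of the larger one, both boundary values
  equal \<open>l\<close> and so agree; gluing along the frontier of \<open>C i\<close> needs
  this.\<close>

lemma frontier_mono:
  assumes "k \<in> I" "p \<in> C k" "C k \<subseteq> C i" "p \<in> M frontier_of C i"
  shows "p \<in> M frontier_of C k"
proof -
  have "p \<notin> M interior_of C i" using assms(4) by (simp add: frontier_of_def)
  then have "p \<notin> M interior_of C k" using interior_of_mono[OF assms(3)] by blast
  moreover have "p \<in> M closure_of C k" using assms(1,2) C_closed closure_of_closedin by fastforce
  ultimately show ?thesis by (simp add: frontier_of_def)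
qed

text \<open>The condition under the description operator in \<open>component_extension\<close>,
  named so that existence and uniqueness can be treated separately.\<close>

definition extends :: "real \<Rightarrow> ('a \<Rightarrow> real) \<Rightarrow> bool" where
  "extends i h \<longleftrightarrow> continuous_map (subtopology M (Ms i)) euclideanreal h \<and> (\<forall>p\<in>D i. h p = l p) \<and>
     (\<forall>K \<in> connected_components_of (subtopology M (Ms i - D i)). h constant_on K) \<and>
     (\<forall>p. p \<notin> Ms i \<longrightarrow> h p = 0)"

text \<open>Collapse each maximal deeper region inside \<open>C i\<close> to its boundary value, and
  everything outside \<open>C i\<close> to the boundary value of \<open>C i\<close>. Off
  \<open>D i\<close> only finitely many values occur, which forces constancy on components.\<close>

lemma extends_exists:
  assumes i: "i \<in> I"
  shows "\<exists>h. extends i h \<and> (\<forall>p\<in>Ms i - C i. h p = boundary_value M l (C i))"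
proof -
  define bv where "bv k = boundary_value M l (C k)" for k
  \<comment> \<open>Maximality under inclusion in terms of indices: by nesting, a region properly
    containing \<open>C k\<close> has an index smaller than \<open>k\<close>.\<close>
  define T where "T = {k \<in> I. i < k \<and> C k \<subseteq> C i \<and> (\<forall>m\<in>I. i < m \<and> m < k \<longrightarrow> \<not> C k \<subseteq> C m)}"
  have T: "k \<in> I" "i < k" "C k \<subseteq> C i" "\<And>m. m \<in> I \<Longrightarrow> i < m \<Longrightarrow> m < k \<Longrightarrow> \<not> C k \<subseteq> C m" if "k \<in> T" for k
    using that unfolding T_def by simp_all
  have finT: "finite T" using finite_I by (simp add: T_def)
  have bv: "l p = bv k" if "k \<in> I" "p \<in> M frontier_of C k" for k p
    using boundary_value[OF that] by (simp add: bv_def)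
  have T_lt: "C j \<inter> C k = {}" if jk: "j \<in> T" "k \<in> T" "j < k" for j k
  proof (rule ccontr)
    assume "C j \<inter> C k \<noteq> {}"
    then obtain p where "p \<in> C j" "p \<in> C k" by blast
    then have "C k \<subseteq> C j" using C_nested[of j k p] T(1) jk by blast
    then show False using T(4)[OF jk(2) T(1)[OF jk(1)] T(2)[OF jk(1)] jk(3)] by blast
  qed
  have T_dis: "pairwise (\<lambda>j k. C j \<inter> C k = {}) T"
    unfolding pairwise_def
  proof (intro ballI impI)
    fix j k assume "j \<in> T" "k \<in> T" "j \<noteq> k"
    then show "C j \<inter> C k = {}" using T_lt[of j k] T_lt[of k j] by (cases "j < k") auto
  qed
  have T_cover: "\<exists>k\<in>T. p \<in> C k" if p: "p \<in> C i" "p \<notin> S i" for p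
  proof -
    \<comment> \<open>Among the deeper regions containing \<open>p\<close>, the one of least index
      is maximal.\<close>
    let ?A = "{k \<in> I. i < k \<and> p \<in> C k}"
    have fin: "finite ?A" using finite_I by simp
    have "?A \<noteq> {}" using p by (auto simp: S_def)
    then have m: "Min ?A \<in> ?A" using fin by (intro Min_in)
    have "C (Min ?A) \<subseteq> C i" using C_nested[OF i, of "Min ?A" p] m p(1) by blast
    moreover have "\<not> C (Min ?A) \<subseteq> C k" if "k \<in> I" "i < k" "k < Min ?A" for k
    proof
      assume "C (Min ?A) \<subseteq> C k"
      then have "k \<in> ?A" using that m by blast
      then show False using Min_le[OF fin, of k] that by simp
    qed
    ultimately have "Min ?A \<in> T" using m unfolding T_def by blast
    then show ?thesis using m by blast
  qed
  have "\<exists>u. continuous_map M euclideanreal u \<and> (\<forall>k\<in>T. \<forall>p\<in>C k. u p = bv k) \<and>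
           (\<forall>p. p \<notin> (\<Union>k\<in>T. C k) \<longrightarrow> u p = l p)"
    using T(1) C_closed bv T_dis by (intro collapse_regions[OF finT]) auto
  then obtain u where u: "continuous_map M euclideanreal u" "\<forall>k\<in>T. \<forall>p\<in>C k. u p = bv k"
    "\<forall>p. p \<notin> (\<Union>k\<in>T. C k) \<longrightarrow> u p = l p"
    by (elim exE conjE)
  \<comment> \<open>For a root region the frontier is empty and \<open>bv i\<close> is unspecified;
    but then \<open>C i = Ms i\<close>, and outside it \<open>?h\<close> is 0.\<close>
  define h where "h p = (if p \<in> C i then u p else bv i)" for p
  have h: "continuous_map M euclideanreal h"
    unfolding h_def
  proof (rule continuous_map_cases)
    show "continuous_map (subtopology M (M closure_of {x. x \<in> C i})) euclideanreal u"
      using u(1) by (rule continuous_map_from_subtopology)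
    fix p assume "p \<in> M frontier_of {x. x \<in> C i}"
    then have p: "p \<in> M frontier_of C i" by simp
    show "u p = bv i"
    proof (cases "p \<in> (\<Union>k\<in>T. C k)")
      case True
      then obtain k where k: "k \<in> T" "p \<in> C k" by blast
      then have "p \<in> M frontier_of C k" using frontier_mono[of k p i] T[OF k(1)] p by blast
      then have "l p = bv k" using bv T(1)[OF k(1)] by blast
      then show ?thesis using u(2) k bv[OF i p] by simp
    next
      case False
      then show ?thesis using u(3) bv[OF i p] by simp
    qed
  qed simp
  have hD: "h p = l p" if p: "p \<in> D i" for p
  proof (cases "p \<in> (\<Union>k\<in>T. C k)")
    case True
    then obtain k where k: "k \<in> T" "p \<in> C k" by blast
    \<comment> \<open>The open interior of \<open>C k\<close> misses \<open>S i\<close>, hence its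
      closure \<open>D i\<close>. A point of \<open>D i\<close> in \<open>C k\<close> is therefore
      on the frontier, where \<open>l\<close> already has the collapsed value.\<close>
    have "S i \<inter> C k = {}" using T[OF k(1)] by (auto simp: S_def)
    then have "M interior_of C k \<inter> S i = {}" using interior_of_subset[of M "C k"] by blast
    then have "M interior_of C k \<inter> M closure_of S i = {}"
      using openin_Int_closure_of_eq_empty[OF openin_interior_of[of M "C k"], of "S i"] by simp
    then have "p \<notin> M interior_of C k" using p by (auto simp: D_def)
    moreover have "p \<in> M closure_of C k" using k T(1) C_closed closure_of_closedin by fastforce
    ultimately have "l p = bv k" using bv[OF T(1)[OF k(1)], of p] by (simp add: frontier_of_def)
    then show ?thesis using u(2) k p D_subset[OF i] by (auto simp: h_def)
  next
    case False
    then show ?thesis using u(3) p D_subset[OF i] by (auto simp: h_def)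
  qed
  have hval: "h p \<in> bv ` insert i T" if p: "p \<notin> D i" for p
  proof (cases "p \<in> C i")
    case True
    then obtain k where "k \<in> T" "p \<in> C k" using T_cover p S_subset_D[OF i] by blast
    then show ?thesis using True u(2) by (simp add: h_def)
  qed (simp add: h_def)
  let ?h = "\<lambda>p. if p \<in> Ms i then h p else 0"
  have "extends i ?h"
    unfolding extends_def
  proof (intro conjI ballI allI impI)
    have "continuous_map (subtopology M (Ms i)) euclideanreal h"
      using h by (rule continuous_map_from_subtopology)
    then show c: "continuous_map (subtopology M (Ms i)) euclideanreal ?h"
      by (rule continuous_map_eq) simp
    show "?h p = l p" if "p \<in> D i" for p
      using that hD D_subset[OF i] Ms(2)[OF i] by auto
    fix K assume K: "K \<in> connected_components_of (subtopology M (Ms i - D i))"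
    have KM: "connectedin M K" "K \<subseteq> Ms i - D i"
      using connectedin_connected_components_of[OF K] by (simp_all add: connectedin_subtopology)
    show "?h constant_on K"
    proof (rule finite_image_constant_on[OF _ KM(1)])
      show "continuous_map (subtopology M K) euclideanreal ?h"
        using c KM(2) by (rule continuous_map_from_subtopology_mono[OF _ order_trans]) blast
      have "?h ` K \<subseteq> bv ` insert i T" using hval KM(2) by auto
      then show "finite (?h ` K)" by (rule finite_subset) (simp add: finT)
    qed
  qed simp
  moreover have "\<forall>p\<in>Ms i - C i. ?h p = boundary_value M l (C i)"
    by (simp add: h_def bv_def)
  ultimately show ?thesis by blast
qed

lemma extends_constant_on_cell:
  assumes i: "i \<in> I" and h: "extends i h" and Q: "Q \<in> \<Q>" "Q \<inter> D i = {}"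
  shows "h constant_on Q"
proof (cases "Q \<subseteq> Ms i")
  case True
  have "connectedin (subtopology M (Ms i - D i)) Q"
    using \<Q>_connected[OF Q(1)] True Q(2) by (auto simp: connectedin_subtopology)
  moreover have "subtopology M (Ms i - D i) \<noteq> trivial_topology"
  proof
    assume "subtopology M (Ms i - D i) = trivial_topology"
    then have "topspace (subtopology M (Ms i - D i)) = {}" by (simp only: topspace_discrete_topology)
    then show False
      using connectedin_subset_topspace[OF calculation] \<Q>_nonempty[OF Q(1)] by blast
  qed
  ultimately obtain K where K: "K \<in> connected_components_of (subtopology M (Ms i - D i))" "Q \<subseteq> K"
    using exists_connected_component_of_superset by blast
  then have "h constant_on K" using h unfolding extends_def by blast
  then show ?thesis using K(2) by (rule constant_on_subset)
next
  case False
  then have "Q \<inter> Ms i = {}" using cell_component[OF Ms(1)[OF i] Q(1)] by blast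
  then show ?thesis using h unfolding extends_def constant_on_def by (intro exI[of _ 0]) blast
qed

text \<open>The difference is 0 on cells inside \<open>S i\<close> and constant on cells off
  \<open>D i\<close> and on single points, hence constant on \<open>Ms i\<close>; it vanishes on the
  nonempty \<open>D i\<close>.\<close>

lemma extends_unique:
  assumes i: "i \<in> I" and h: "extends i h" "extends i h'"
  shows "h = h'"
proof
  fix p
  let ?d = "\<lambda>p. h p - h' p"
  have "?d constant_on Ms i"
  proof (rule constant_on_component[OF Ms(1)[OF i]])
    show "continuous_map (subtopology M (Ms i)) euclideanreal ?d"
      using h unfolding extends_def by (intro continuous_map_diff) simp_all
    fix Q assume Q: "Q \<in> \<Q>"
    from \<Q>_D[OF Q i] show "?d constant_on Q"
    proof (elim disjE exE)
      assume "Q \<subseteq> S i"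
      then have "\<forall>p\<in>Q. ?d p = 0" using h S_subset_D[OF i] unfolding extends_def by auto
      then show ?thesis unfolding constant_on_def by blast
    next
      assume "Q \<inter> D i = {}"
      then have "h constant_on Q" "h' constant_on Q" using extends_constant_on_cell[OF i _ Q] h by blast+
      then show ?thesis unfolding constant_on_def by fastforce
    qed (auto simp: constant_on_def)
  qed
  then obtain y where y: "\<forall>p\<in>Ms i. ?d p = y" unfolding constant_on_def by blast
  obtain q where q: "q \<in> D i" using D_nonempty[OF i] by blast
  have "?d q = 0" using q h unfolding extends_def by simp
  moreover have "q \<in> Ms i" using q D_subset[OF i] Ms(2)[OF i] by blast
  ultimately have "y = 0" using y by auto
  then show "h p = h' p" using y h unfolding extends_def by (cases "p \<in> Ms i") auto
qed

lemma component_extension: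
  assumes i: "i \<in> I"
  shows "extends i (component_extension M l (D i))"
    "\<And>p. p \<in> Ms i \<Longrightarrow> p \<notin> C i \<Longrightarrow> component_extension M l (D i) p = boundary_value M l (C i)"
proof -
  obtain h where h: "extends i h" "\<forall>p\<in>Ms i - C i. h p = boundary_value M l (C i)"
    using extends_exists[OF i] by blast
  have "component_extension M l (D i) = (THE h. extends i h)"
    by (simp add: component_extension_def extends_def Let_def)
  also have "\<dots> = h" using h(1) extends_unique[OF i] by (intro the_equality) blast+
  finally show "extends i (component_extension M l (D i))"
    "\<And>p. p \<in> Ms i \<Longrightarrow> p \<notin> C i \<Longrightarrow> component_extension M l (D i) p = boundary_value M l (C i)"
    using h by simp_all
qed

section \<open>The normalized functions and their combinations\<close>

abbreviation \<alpha> :: "real \<Rightarrow> real" where "\<alpha> \<equiv> amplitude M l I C"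
abbreviation \<gamma> :: "real \<Rightarrow> 'a \<Rightarrow> real" where "\<gamma> \<equiv> middle_varilet M l I C"

text \<open>The amount subtracted by the normalization, so that root and other indices share one
  formula.\<close>

definition base :: "real \<Rightarrow> real" where
  "base i = (if is_root M C i then 0 else boundary_value M l (C i))"

lemma \<gamma>_eq:
  "\<gamma> i p = (if p \<in> Ms i then inverse (\<alpha> i) * (component_extension M l (D i) p - base i) else 0)"
  by (simp add: middle_varilet_def Let_def base_def)

lemma continuous_\<gamma>: assumes i: "i \<in> I" shows "continuous_map M euclideanreal (\<gamma> i)"
proof -
  let ?e = "component_extension M l (D i)"
  have clopen: "closedin M (Ms i)" "openin M (Ms i)"
    using Ms(1)[OF i] closedin_connected_components_of openin_component by blast+
  have e: "continuous_map (subtopology M (Ms i)) euclideanreal ?e"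
    using component_extension(1)[OF i] unfolding extends_def by simp
  have "continuous_map M euclideanreal (\<lambda>p. if p \<in> Ms i then inverse (\<alpha> i) * (?e p - base i) else 0)"
  proof (rule continuous_map_cases)
    have "M closure_of Ms i = Ms i" using clopen(1) by (rule closure_of_closedin)
    then show "continuous_map (subtopology M (M closure_of {x. x \<in> Ms i})) euclideanreal
        (\<lambda>p. inverse (\<alpha> i) * (?e p - base i))"
      using e by (auto intro!: continuous_map_real_mult continuous_map_diff)
    have "M frontier_of Ms i = {}" using clopen clopenin_eq_frontier_of[of M "Ms i"] by simp
    then show "inverse (\<alpha> i) * (?e p - base i) = 0" if "p \<in> M frontier_of {x. x \<in> Ms i}" for p
      using that by simp
  qed simp
  moreover have "\<gamma> i = (\<lambda>p. if p \<in> Ms i then inverse (\<alpha> i) * (?e p - base i) else 0)"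
    by (rule ext) (rule \<gamma>_eq)
  ultimately show ?thesis by simp
qed

lemma \<gamma>_on_D: assumes i: "i \<in> I" and p: "p \<in> D i" shows "\<gamma> i p = (l p - base i) / \<alpha> i"
proof -
  have "p \<in> Ms i" using p D_subset[OF i] Ms(2)[OF i] by blast
  moreover have "component_extension M l (D i) p = l p"
    using p component_extension(1)[OF i] unfolding extends_def by blast
  ultimately show ?thesis by (simp add: \<gamma>_eq field_simps)
qed

text \<open>For a root, \<open>C i\<close> is all of \<open>Ms i\<close>. Otherwise the extension
  equals the boundary value on \<open>Ms i - C i\<close>, which the normalization cancels.\<close>

lemma \<gamma>_outside: assumes i: "i \<in> I" and p: "p \<notin> C i" shows "\<gamma> i p = 0"
proof (cases "p \<in> Ms i")
  case True
  have "\<not> is_root M C i"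
  proof
    assume "is_root M C i"
    then have "C i \<in> connected_components_of M" by (simp add: is_root_def)
    then have "C i = Ms i"
      using connected_components_of_overlap[of "C i" M "Ms i"] Ms[OF i] C_nonempty[OF i] by blast
    then show False using True p by simp
  qed
  then show ?thesis using component_extension(2)[OF i True p] by (simp add: \<gamma>_eq base_def)
qed (simp add: \<gamma>_eq)

text \<open>A cell of another index is a point or misses \<open>D i\<close>, where the extension is
  constant on it; continuity carries this to the closure.\<close>

lemma \<gamma>_constant: assumes i: "i \<in> I" and Q: "Q \<in> \<Q>" "index Q \<noteq> i"
  shows "\<gamma> i constant_on (M closure_of Q)"
proof (rule constant_on_closure_of[OF continuous_\<gamma>[OF i] \<Q>_subset[OF Q(1)]])
  from \<Q>_D[OF Q(1) i] show "\<gamma> i constant_on Q"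
  proof (elim disjE exE)
    assume "Q \<subseteq> S i"
    then have "Q \<subseteq> S i \<inter> S (index Q)" using index(2)[OF Q(1)] by blast
    then show ?thesis
      using S_disjoint[OF i index(1)[OF Q(1)]] Q(2) \<Q>_nonempty[OF Q(1)] by auto
  next
    assume QD: "Q \<inter> D i = {}"
    have "component_extension M l (D i) constant_on Q"
      by (rule extends_constant_on_cell[OF i component_extension(1)[OF i] Q(1) QD])
    then obtain y where y: "\<forall>p\<in>Q. component_extension M l (D i) p = y"
      unfolding constant_on_def by blast
    have "Q \<subseteq> Ms i \<or> Q \<inter> Ms i = {}" using cell_component[OF Ms(1)[OF i] Q(1)] .
    then show ?thesis
    proof
      assume "Q \<subseteq> Ms i"
      then have "\<forall>p\<in>Q. \<gamma> i p = inverse (\<alpha> i) * (y - base i)" using y by (auto simp: \<gamma>_eq)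
      then show ?thesis unfolding constant_on_def by blast
    next
      assume "Q \<inter> Ms i = {}"
      then have "\<forall>p\<in>Q. \<gamma> i p = 0" by (auto simp: \<gamma>_eq)
      then show ?thesis unfolding constant_on_def by blast
    qed
  qed (auto simp: constant_on_def)
qed

lemma combination_on_cell:
  assumes Q: "Q \<in> \<Q>"
  shows "\<exists>c. \<forall>p\<in>M closure_of Q. (\<Sum>i\<in>I. a i * \<gamma> i p) = a (index Q) / \<alpha> (index Q) * l p + c"
proof -
  note k = index[OF Q]
  have "\<exists>c. \<forall>p\<in>M closure_of Q. \<gamma> i p = c" if "i \<in> I - {index Q}" for i
    using \<gamma>_constant[of i Q] that Q unfolding constant_on_def by blast
  then obtain c where c: "\<And>i p. i \<in> I - {index Q} \<Longrightarrow> p \<in> M closure_of Q \<Longrightarrow> \<gamma> i p = c i"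
    by metis
  have sub: "M closure_of Q \<subseteq> D (index Q)" using D_eq[OF k(1)] Q by blast
  have "(\<Sum>i\<in>I. a i * \<gamma> i p) = a (index Q) / \<alpha> (index Q) * l p +
      ((\<Sum>i\<in>I - {index Q}. a i * c i) - a (index Q) * base (index Q) / \<alpha> (index Q))"
    if p: "p \<in> M closure_of Q" for p
  proof -
    have "\<gamma> (index Q) p = (l p - base (index Q)) / \<alpha> (index Q)"
      using \<gamma>_on_D[OF k(1)] sub p by blast
    then have "a (index Q) * \<gamma> (index Q) p =
        a (index Q) / \<alpha> (index Q) * l p - a (index Q) * base (index Q) / \<alpha> (index Q)"
      by (simp add: diff_divide_distrib right_diff_distrib)
    moreover have "(\<Sum>i\<in>I - {index Q}. a i * \<gamma> i p) = (\<Sum>i\<in>I - {index Q}. a i * c i)"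
      using c p by (intro sum.cong) auto
    ultimately show ?thesis
      using sum.remove[OF finite_I k(1), of "\<lambda>i. a i * \<gamma> i p"]
      by simp
  qed
  then show ?thesis by blast
qed

text \<open>Regions meeting \<open>K\<close> lie in \<open>K\<close> and cover it, so the one of
  least index is all of \<open>K\<close>. Minimality is recorded because, with the definition of
  \<open>S i\<close>, it leaves no other region containing a point of \<open>S i\<close>.\<close>

lemma component_is_region:
  assumes K: "K \<in> connected_components_of M"
  obtains i where "i \<in> I" "C i = K" "\<And>j. j \<in> I \<Longrightarrow> j < i \<Longrightarrow> C j \<inter> K = {}"
proof -
  let ?T = "{j \<in> I. C j \<inter> K \<noteq> {}}"
  have sub: "C j \<subseteq> K" if "j \<in> ?T" for j
    using connected_components_of_maximal[OF K, of "C j"] C_connected[of j] that by (auto simp: disjnt_def)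
  have "K \<subseteq> (\<Union>i\<in>I. C i)" using C_Union connected_components_of_subset[OF K] by blast
  then have eq: "K = (\<Union>j\<in>?T. C j)" using sub by blast
  have ne: "?T \<noteq> {}"
  proof
    assume e: "?T = {}"
    show False using eq nonempty_connected_components_of[OF K] unfolding e by simp
  qed
  have "C (Min ?T) = K"
    by (rule connected_union_of_regions[OF connectedin_connected_components_of[OF K] _ ne eq]) blast
  moreover have "Min ?T \<in> ?T" using ne finite_I by (intro Min_in) auto
  moreover have "C j \<inter> K = {}" if "j \<in> I" "j < Min ?T" for j
  proof (rule ccontr)
    assume "C j \<inter> K \<noteq> {}"
    then have "Min ?T \<le> j" using that(1) finite_I by (intro Min_le) auto
    then show False using that(2) by simp
  qed
  ultimately show ?thesis using that by blast
qed

lemma reconstruction: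
  assumes p: "p \<in> topspace M"
  shows "(\<Sum>i\<in>I. \<alpha> i * \<gamma> i p) = l p"
proof -
  let ?d = "\<lambda>p. (\<Sum>i\<in>I. \<alpha> i * \<gamma> i p) - l p"
  have "p \<in> \<Union>(connected_components_of M)" using p by (simp add: Union_connected_components_of)
  then obtain K where K: "K \<in> connected_components_of M" "p \<in> K" by blast
  have "?d constant_on K"
  proof (rule constant_on_component[OF K(1)])
    have "continuous_map M euclideanreal ?d"
      using finite_I continuous_\<gamma> cont
      by (intro continuous_map_diff continuous_map_sum continuous_map_real_mult) auto
    then show "continuous_map (subtopology M K) euclideanreal ?d"
      by (rule continuous_map_from_subtopology)
    fix Q assume Q: "Q \<in> \<Q>"
    obtain c where c: "\<forall>p\<in>M closure_of Q.
        (\<Sum>i\<in>I. \<alpha> i * \<gamma> i p) = \<alpha> (index Q) / \<alpha> (index Q) * l p + c"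
      using combination_on_cell[OF Q, of \<alpha>] by blast
    have "\<alpha> (index Q) \<noteq> 0" using amplitude_pos[OF index(1)[OF Q]] by simp
    then have "\<forall>p\<in>Q. ?d p = c" using c \<Q>_closure[OF Q] by auto
    then show "?d constant_on Q" unfolding constant_on_def by blast
  qed
  then obtain y where y: "\<forall>p\<in>K. ?d p = y" unfolding constant_on_def by blast
  obtain i where i: "i \<in> I" "C i = K" "\<And>j. j \<in> I \<Longrightarrow> j < i \<Longrightarrow> C j \<inter> K = {}"
    using component_is_region[OF K(1)] by blast
  obtain q where q: "q \<in> S i" using S_nonempty[OF i(1)] by blast
  have qK: "q \<in> K" using q i(2) by (auto simp: S_def)
  have "\<gamma> j q = 0" if j: "j \<in> I - {i}" for j
  proof (rule \<gamma>_outside)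
    show "q \<notin> C j"
    proof (cases "j < i")
      case True
      then show ?thesis using i(3)[of j] j qK by blast
    next
      case False
      then have "i < j" using j by simp
      then show ?thesis using q j by (auto simp: S_def)
    qed
  qed (use j in blast)
  then have "(\<Sum>j\<in>I - {i}. \<alpha> j * \<gamma> j q) = 0" by (intro sum.neutral) simp
  \<comment> \<open>For a root nothing is subtracted, so the one surviving term at \<open>q\<close>
    is exactly \<open>l q\<close>.\<close>
  moreover have "base i = 0" using i(2) K(1) by (simp add: base_def is_root_def)
  moreover have "\<gamma> i q = (l q - base i) / \<alpha> i" using \<gamma>_on_D[OF i(1)] S_subset_D[OF i(1)] q by blast
  ultimately have "?d q = 0"
    using sum.remove[OF finite_I i(1), of "\<lambda>i. \<alpha> i * \<gamma> i q"] amplitude_pos[OF i(1)] by simp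
  then have "y = 0" using y qK by auto
  then show ?thesis using y K(2) by auto
qed

end

section \<open>The varilet basis\<close>

lemma image_length_affine:
  assumes "compact_Hausdorff_function M l" "closedin M A" "A \<noteq> {}" and g: "\<forall>p\<in>A. g p = s * l p + c"
  shows "image_length g A = \<bar>s\<bar> * image_length l A"
proof -
  interpret compact_Hausdorff_function M l by fact
  obtain a b where ab: "a \<in> A" "b \<in> A" "\<And>q. q \<in> A \<Longrightarrow> l a \<le> l q \<and> l q \<le> l b"
    using attains_range[OF assms(2,3)] by blast
  have len: "image_length l A = l b - l a" by (rule image_length_eq[OF ab])
  show ?thesis
  proof (cases "0 \<le> s")
    case True
    have "image_length g A = g b - g a"
      using ab g True by (intro image_length_eq) (simp_all add: mult_left_mono)
    then show ?thesis using len g ab True by (simp add: right_diff_distrib)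
  next
    case False
    have "image_length g A = g a - g b"
      using ab g False by (intro image_length_eq) (simp_all add: mult_left_mono_neg)
    then show ?thesis using len g ab False by (simp add: right_diff_distrib)
  qed
qed

text \<open>A negative slope exchanges maxima and minima, which is why \<open>extremal\<close> does
  not distinguish them.\<close>

lemma extremal_affine:
  assumes "extremal l A p" "p \<in> A" and g: "\<forall>p\<in>A. g p = s * l p + c"
  shows "extremal g A p"
proof (cases "0 \<le> s")
  case True
  then show ?thesis using assms unfolding extremal_def by (auto intro: mult_left_mono)
next
  case False
  then show ?thesis using assms unfolding extremal_def by (auto intro: mult_left_mono_neg)
qed

text \<open>Preimages of connected sets under the closed monotone quotient map are connected; this
  serves for the members and for their fibres. Lengths persist because \<open>P j\<close> maps onto
  \<open>A j\<close>.\<close>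

lemma monotone_cover_preimage:
  assumes X: "compact_Hausdorff_function X f" and c: "monotone_cover (middle_space X f) h J A"
  defines "P j \<equiv> {x \<in> topspace X. monotone_part X f x \<in> A j}"
  shows "monotone_cover X (h \<circ> monotone_part X f) J P"
    and "j \<in> J \<Longrightarrow> image_length (h \<circ> monotone_part X f) (P j) = image_length h (A j)"
proof -
  interpret compact_Hausdorff_function X f by fact
  let ?M = "middle_space X f" and ?m = "monotone_part X f"
  have fin: "finite J" and un: "(\<Union>j\<in>J. A j) = topspace ?M"
    and arc: "\<forall>j\<in>J. closedin ?M (A j) \<and> connectedin ?M (A j) \<and> A j \<noteq> {} \<and>
        (\<forall>y. connectedin ?M {x \<in> A j. h x = y})"
    and ext: "\<forall>j\<in>J. \<forall>k\<in>J. j \<noteq> k \<longrightarrow> (\<forall>x\<in>A j \<inter> A k. extremal h (A j) x)"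
    using c unfolding monotone_cover_def by simp_all
  have img: "?m ` P j = A j" if j: "j \<in> J" for j
  proof -
    have "A j \<subseteq> ?m ` topspace X" using un j unfolding topspace_middle_space by blast
    then show ?thesis unfolding P_def by blast
  qed
  show "image_length (h \<circ> ?m) (P j) = image_length h (A j)" if "j \<in> J"
    unfolding image_length_def image_comp[symmetric] img[OF that] ..
  note conn = connectedin_monotone_part_preimage[OF compact Hausdorff cont]
  show "monotone_cover X (h \<circ> ?m) J P"
    unfolding monotone_cover_def
  proof (intro conjI ballI impI allI)
    show "finite J" by (rule fin)
    show "(\<Union>j\<in>J. P j) = topspace X"
    proof (intro equalityI subsetI)
      fix x assume x: "x \<in> topspace X"
      then have "?m x \<in> (\<Union>j\<in>J. A j)" unfolding un topspace_middle_space by blast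
      then show "x \<in> (\<Union>j\<in>J. P j)" using x by (auto simp: P_def)
    qed (auto simp: P_def)
    fix j assume j: "j \<in> J"
    show "closedin X (P j)"
      unfolding P_def using arc j by (intro closedin_continuous_map_preimage[OF continuous_map_monotone_part]) blast
    show "connectedin X (P j)" unfolding P_def using arc j by (intro conn) blast
    show "P j \<noteq> {}"
    proof
      assume "P j = {}"
      then have "A j = {}" using img[OF j] by simp
      then show False using arc j by simp
    qed
    show "connectedin X {x \<in> P j. (h \<circ> ?m) x = y}" for y
    proof -
      have "connectedin ?M {p \<in> A j. h p = y}" using arc j by simp
      then have "connectedin X {x \<in> topspace X. ?m x \<in> {p \<in> A j. h p = y}}" by (rule conn)
      then show ?thesis unfolding P_def comp_def by (simp add: conj_assoc)
    qed
    fix k x assume "k \<in> J" "j \<noteq> k" "x \<in> P j \<inter> P k"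
    then have "extremal h (A j) (?m x)" using ext j by (simp add: P_def)
    then show "extremal (h \<circ> ?m) (P j) x" unfolding extremal_def P_def by auto
  qed
qed

text \<open>An isolated point would be a clopen subset of \<open>X\<close>, so it would contain a
  whole component of \<open>X\<close>, on which \<open>f\<close> would be constant.\<close>

lemma middle_space_no_isolated:
  assumes X: "compact_Hausdorff_function X f"
    and nonconst: "\<forall>K \<in> connected_components_of X. \<not> f constant_on K"
  shows "\<not> openin (middle_space X f) {p}"
proof
  interpret compact_Hausdorff_function X f by fact
  let ?M = "middle_space X f" and ?m = "monotone_part X f"
  assume op: "openin ?M {p}"
  then have "p \<in> topspace ?M" using openin_subset by blast
  then obtain x where x: "x \<in> topspace X" "p = ?m x" unfolding topspace_middle_space by blast
  have eq: "{y \<in> topspace X. ?m y \<in> {p}} = p"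
    using monotone_part_eq_iff[OF x(1)] monotone_part_subset[of X f x] x(2) by auto
  have "closedin ?M {p}"
    using closedin_Hausdorff_singleton[OF Hausdorff_space_middle_space[OF compact Hausdorff cont]]
      \<open>p \<in> topspace ?M\<close> by blast
  then have "closedin X p"
    using closedin_continuous_map_preimage[OF continuous_map_monotone_part] eq by metis
  moreover have "openin X p"
    using openin_continuous_map_preimage[OF continuous_map_monotone_part op] eq by simp
  moreover have "x \<in> p" using monotone_part_self[OF x(1)] x(2) by simp
  ultimately have "connected_component_of_set X x \<subseteq> p"
    using connectedin_clopen_cases[OF connectedin_connected_component_of[of X x], of p]
      connected_component_of_refl[of X x] x(1) by (auto simp: disjnt_iff)
  then have "f constant_on connected_component_of_set X x"
    using monotone_part_subset[of X f x] x(2) unfolding constant_on_def by blast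
  then show False
    using nonconst x(1) by (meson connected_component_in_connected_components_of)
qed

context varilet_cells
begin

text \<open>The same cells serve all coefficients. If \<open>a (index Q)\<close> is 0 the
  combination is constant on the closed cell, otherwise injective.\<close>

lemma combination_cover:
  "monotone_cover M (\<lambda>p. \<Sum>i\<in>I. a i * \<gamma> i p) \<Q> ((closure_of) M)" (is "monotone_cover M ?h _ _")
  and combination_length:
  "(\<Sum>Q\<in>\<Q>. image_length (\<lambda>p. \<Sum>i\<in>I. a i * \<gamma> i p) (M closure_of Q)) = (\<Sum>i\<in>I. \<bar>a i\<bar>)"
proof -
  have ne: "M closure_of Q \<noteq> {}" if "Q \<in> \<Q>" for Q
    using that \<Q>_nonempty[of Q] \<Q>_closure[of Q] by blast
  show "monotone_cover M ?h \<Q> ((closure_of) M)"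
  proof (rule monotone_cover_arcs)
    show "finite \<Q>" by (rule finite_\<Q>)
    show "(\<Union>Q\<in>\<Q>. M closure_of Q) = topspace M"
      using \<Q>_Union \<Q>_closure closure_of_subset_topspace[of M] by blast
    fix Q assume Q: "Q \<in> \<Q>"
    obtain c where c: "\<forall>p\<in>M closure_of Q. ?h p = a (index Q) / \<alpha> (index Q) * l p + c"
      using combination_on_cell[OF Q, of a] by blast
    show "connectedin M (M closure_of Q)" using \<Q>_connected[OF Q] by (rule connectedin_closure_of)
    show "inj_on ?h (M closure_of Q) \<or> ?h constant_on (M closure_of Q)"
    proof (cases "a (index Q) = 0")
      case True
      then show ?thesis using c unfolding constant_on_def by auto
    next
      case False
      then have "a (index Q) / \<alpha> (index Q) \<noteq> 0" using amplitude_pos[OF index(1)[OF Q]] by simp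
      then have "inj_on ?h (M closure_of Q)"
        using c inj_onD[OF \<Q>_inj[OF Q]] by (auto simp: inj_on_def)
      then show ?thesis ..
    qed
    show "extremal ?h (M closure_of Q) p"
      if "R \<in> \<Q>" "Q \<noteq> R" "p \<in> M closure_of Q" "p \<in> M closure_of R" for R p
      using extremal_affine[OF \<Q>_extremal[OF Q that] that(3) c] .
  qed (auto dest: ne)
  have "image_length ?h (M closure_of Q) = \<bar>a (index Q)\<bar> / \<alpha> (index Q) * image_length l (M closure_of Q)"
    if Q: "Q \<in> \<Q>" for Q
  proof -
    obtain c where c: "\<forall>p\<in>M closure_of Q. ?h p = a (index Q) / \<alpha> (index Q) * l p + c"
      using combination_on_cell[OF Q, of a] by blast
    show ?thesis
      using image_length_affine[OF compact_Hausdorff_function_axioms closedin_closure_of ne[OF Q] c]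
        amplitude_pos[OF index(1)[OF Q]] by (simp add: abs_divide)
  qed
  then have "(\<Sum>Q\<in>\<Q>. image_length ?h (M closure_of Q))
      = (\<Sum>Q\<in>\<Q>. \<bar>a (index Q)\<bar> / \<alpha> (index Q) * image_length l (M closure_of Q))"
    by (intro sum.cong) simp_all
  also have "\<dots> = (\<Sum>i\<in>I. \<Sum>Q\<in>{Q \<in> \<Q>. index Q = i}.
      \<bar>a (index Q)\<bar> / \<alpha> (index Q) * image_length l (M closure_of Q))"
    using index(1) by (intro sum.group[symmetric] finite_\<Q> finite_I) auto
  also have "\<dots> = (\<Sum>i\<in>I. \<bar>a i\<bar>)"
  proof (rule sum.cong)
    fix i assume i: "i \<in> I"
    have "(\<Sum>Q\<in>{Q \<in> \<Q>. index Q = i}. \<bar>a (index Q)\<bar> / \<alpha> (index Q) * image_length l (M closure_of Q))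
        = \<bar>a i\<bar> / \<alpha> i * (\<Sum>Q\<in>{Q \<in> \<Q>. index Q = i}. image_length l (M closure_of Q))"
      unfolding sum_distrib_left by (intro sum.cong) simp_all
    then show "(\<Sum>Q\<in>{Q \<in> \<Q>. index Q = i}. \<bar>a (index Q)\<bar> / \<alpha> (index Q) * image_length l (M closure_of Q))
        = \<bar>a i\<bar>"
      using amplitude_pos[OF i] unfolding amplitude_eq[OF i, symmetric] by simp
  qed simp
  finally show "(\<Sum>Q\<in>\<Q>. image_length ?h (M closure_of Q)) = (\<Sum>i\<in>I. \<bar>a i\<bar>)" .
qed

lemma continuous_combination: "continuous_map M euclideanreal (\<lambda>p. \<Sum>i\<in>I. a i * \<gamma> i p)"
  using finite_I continuous_\<gamma> by (intro continuous_map_sum continuous_map_real_mult) auto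

end

theorem theorem3p1:
  fixes X :: "'a topology" and f :: "'a \<Rightarrow> real"
    and I :: "real set" and C :: "real \<Rightarrow> 'a set set"
  assumes "compact_space X" and "metrizable_space X"
    and "piecewise_monotone X f"
    and "\<forall>K \<in> connected_components_of X. \<not> f constant_on K"
    and "varilet_lens (middle_space X f) (light_part f) I C"
  shows "varilet_basis X I (varilet X f I C) \<and>
         (\<forall>x \<in> topspace X. f x = (\<Sum>i\<in>I. varilet_amplitude X f I C i * varilet X f I C i x))"
proof -
  define M where "M = middle_space X f"
  define l where "l = light_part f"
  have X: "compact_Hausdorff_function X f"
    using assms(1-3) metrizable_imp_Hausdorff_space
    unfolding compact_Hausdorff_function_def piecewise_monotone_def by blast
  interpret M: compact_Hausdorff_function M l
    unfolding M_def l_def by (rule compact_Hausdorff_function_middle_space[OF X])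
  have lens: "varilet_lens M l I C" using assms(5) by (simp add: M_def l_def)
  then have reg: "finite I" "\<forall>i\<in>I. l constant_on (M frontier_of C i)"
    unfolding varilet_lens_def constant_boundary_region_def by auto
  have "finite (l ` (M frontier_of C i))" if i: "i \<in> I" for i
  proof -
    obtain y where "\<forall>p\<in>M frontier_of C i. l p = y" using reg(2) i unfolding constant_on_def by blast
    then have "l ` (M frontier_of C i) \<subseteq> {y}" by blast
    then show ?thesis by (rule finite_subset) simp
  qed
  then have "finite (\<Union>i\<in>I. l ` (M frontier_of C i))" using reg(1) by simp
  then obtain \<Q> where \<Q>: "cell_decomposition M l (\<Union>i\<in>I. l ` (M frontier_of C i)) \<Q>"
    using M.cell_decomposition_exists[of "edges M l"] piecewise_monotone_edges[OF X assms(3)]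
    unfolding M_def l_def by blast
  interpret varilet_cells M l I C \<Q>
    using lens \<Q> middle_space_no_isolated[OF X assms(4)] unfolding M_def[symmetric]
    by unfold_locales
  have g: "varilet X f I C i x = \<gamma> i (monotone_part X f x)" for i x
    by (simp add: varilet_def M_def l_def)
  have comb: "piecewise_monotone X (\<lambda>x. \<Sum>i\<in>I. a i * varilet X f I C i x) \<and>
      TTV X (\<lambda>x. \<Sum>i\<in>I. a i * varilet X f I C i x) = (\<Sum>i\<in>I. \<bar>a i\<bar>)" for a
  proof -
    let ?h = "\<lambda>p. \<Sum>i\<in>I. a i * \<gamma> i p"
    have eq: "(\<lambda>x. \<Sum>i\<in>I. a i * varilet X f I C i x) = ?h \<circ> monotone_part X f"
      by (simp add: g comp_def)
    have "continuous_map X euclideanreal (?h \<circ> monotone_part X f)"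
      using continuous_combination continuous_map_monotone_part unfolding M_def
      by (rule continuous_map_compose[rotated])
    then have H: "compact_Hausdorff_function X (?h \<circ> monotone_part X f)"
      using X by (simp add: compact_Hausdorff_function_def)
    \<comment> \<open>The cover lives on the middle space of \<open>f\<close>, but the total
      variation of the combination is defined through its own middle space, so the cover is first
      pulled back to \<open>X\<close>.\<close>
    note pre = monotone_cover_preimage[OF X combination_cover[of a, unfolded M_def], folded M_def]
    have "TTV X (?h \<circ> monotone_part X f) = (\<Sum>i\<in>I. \<bar>a i\<bar>)"
      using monotone_cover_TTV(2)[OF H pre(1)] pre(2) combination_length[of a] by simp
    then show ?thesis
      unfolding eq using monotone_cover_TTV(1)[OF H pre(1)] by blast
  qed
  have "piecewise_monotone X (varilet X f I C i)" if i: "i \<in> I" for i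
  proof -
    \<comment> \<open>A single varilet is the combination with coefficient 1 at \<open>i\<close> and
      0 elsewhere.\<close>
    have "(\<lambda>x. \<Sum>j\<in>I. (if j = i then 1 else 0) * varilet X f I C j x) = varilet X f I C i"
      using i finite_I by (simp add: if_distrib[of "\<lambda>c. c * _"] sum.delta cong: if_cong)
    then show ?thesis using comb[of "\<lambda>j. if j = i then 1 else 0"] by simp
  qed
  then have "varilet_basis X I (varilet X f I C)"
    unfolding varilet_basis_def using finite_I comb by blast
  moreover have "f x = (\<Sum>i\<in>I. varilet_amplitude X f I C i * varilet X f I C i x)"
    if x: "x \<in> topspace X" for x
  proof -
    have "monotone_part X f x \<in> topspace M" using x by (simp add: M_def topspace_middle_space)
    then have "(\<Sum>i\<in>I. \<alpha> i * \<gamma> i (monotone_part X f x)) = l (monotone_part X f x)"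
      by (rule reconstruction)
    then show ?thesis
      using light_part_monotone_part[OF x, of f] by (simp add: g varilet_amplitude_def M_def l_def)
  qed
  ultimately show ?thesis by blast
qed

end
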